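(* For all integers $n\ge1$ and $0\le m\le n^2-1$, $$\operatorname{slog}(n,m+1)\ \le\ \chi(n,m)\ \le\ \operatorname{slog}(n,(m+1)^2).$$ In particular, for each fixed $m\ge1$, $\chi(n,m)\to\infty$ as $n\to\infty$ (so there is no bound on the chromatic number of quantum graphs depending only on the valence $m$).
   Context: A quantum graph $G$ consists of a finite-dimensional complex inner product space $V(G)$ and a real vector space $E(G)$ of self-adjoint operators on $V(G)$ containing the identity $I$; write $|G|=\dim V(G)$ and $\|G\|=\dim E(G)-1$ (the valence). A code of $G$ is a subspace $C\subseteq V(G)$ such that there is a function $\epsilon_C:E(G)\to\mathbb{R}$ with $P_CAP_C=\epsilon_C(A)P_C$ for all $A\in E(G)$, where $P_C$ is the orthogonal projection onto $C$. A coloring of $G$ is a set $K$ of codes of $G$ with $\sum_{C\in K}P_C=I$. The chromatic number $\chi(G)$ is the smallest cardinality of a coloring of $G$. $\chi(n,m)$ is the maximum of $\chi(G)$ over all quantum graphs $G$ with $|G|=n$ and $\|G\|=m$. The step logarithm is defined for positive integers $q$ and nonnegative integers $p$ by $\operatorname{slog}(0,q)=0$ and $\operatorname{slog}(p,q)=\operatorname{slog}(p-\lceil p/q\rceil,q)+1$ for $p\ge1$. *)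

theory Defs
  imports Complex_Main "Jordan_Normal_Form.Schur_Decomposition"
begin

text \<open>Step logarithm slog(p,q); the recursion is only meaningful for q \<ge> 1,
  for q = 0 we set the value to 0 (never used).\<close>
function slog :: "nat \<Rightarrow> nat \<Rightarrow> nat" where
  "slog p q = (if p = 0 \<or> q = 0 then 0
               else slog (p - nat \<lceil>real p / real q\<rceil>) q + 1)"
  by pat_completeness auto
termination
proof (relation "measure fst")
  fix p q :: nat
  assume "\<not> (p = 0 \<or> q = 0)"
  then have "real p / real q > 0" by simp
  then have "nat \<lceil>real p / real q\<rceil> \<ge> 1" by linarith
  then show "((p - nat \<lceil>real p / real q\<rceil>, q), p, q) \<in> measure fst"
    using \<open>\<not> (p = 0 \<or> q = 0)\<close> by simp
qed simp

text \<open>V(G) = C^n, operators are n x n complex matrices.\<close>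
definition self_adjoint :: "nat \<Rightarrow> complex mat \<Rightarrow> bool" where
  "self_adjoint n A \<longleftrightarrow> A \<in> carrier_mat n n \<and> mat_adjoint A = A"

definition real_lincomb :: "nat \<Rightarrow> (nat \<Rightarrow> real) \<Rightarrow> complex mat list \<Rightarrow> complex mat" where
  "real_lincomb n c bs =
     mat n n (\<lambda>(i,j). \<Sum>k<length bs. complex_of_real (c k) * (bs ! k) $$ (i,j))"

definition real_space_dim :: "nat \<Rightarrow> complex mat set \<Rightarrow> nat \<Rightarrow> bool" where
  "real_space_dim n E d \<longleftrightarrow>
     (\<exists>bs. length bs = d \<and> set bs \<subseteq> carrier_mat n n \<and>
        E = {real_lincomb n c bs | c. True} \<and>
        (\<forall>c. real_lincomb n c bs = 0\<^sub>m n n \<longrightarrow> (\<forall>k<d. c k = 0)))"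

text \<open>Quantum graph G with |G| = n and valence ||G|| = m: a real vector space E
  of self-adjoint operators on C^n containing the identity, with dim E = m + 1.\<close>
definition quantum_graph :: "nat \<Rightarrow> nat \<Rightarrow> complex mat set \<Rightarrow> bool" where
  "quantum_graph n m E \<longleftrightarrow>
     (\<forall>A\<in>E. self_adjoint n A) \<and> 1\<^sub>m n \<in> E \<and> real_space_dim n E (m + 1)"

text \<open>Orthogonal projections on C^n; these correspond bijectively to subspaces
  C of C^n (P = P_C).\<close>
definition orth_proj :: "nat \<Rightarrow> complex mat \<Rightarrow> bool" where
  "orth_proj n P \<longleftrightarrow> P \<in> carrier_mat n n \<and> P * P = P \<and> mat_adjoint P = P"

text \<open>A code of the quantum graph E, given via its orthogonal projection P = P_C.\<close>
definition is_code :: "nat \<Rightarrow> complex mat set \<Rightarrow> complex mat \<Rightarrow> bool" where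
  "is_code n E P \<longleftrightarrow> orth_proj n P \<and>
     (\<exists>\<epsilon> :: complex mat \<Rightarrow> real. \<forall>A\<in>E. P * A * P = complex_of_real (\<epsilon> A) \<cdot>\<^sub>m P)"

definition is_coloring :: "nat \<Rightarrow> complex mat set \<Rightarrow> complex mat set \<Rightarrow> bool" where
  "is_coloring n E K \<longleftrightarrow> finite K \<and> (\<forall>P\<in>K. is_code n E P) \<and>
     (\<forall>i<n. \<forall>j<n. (\<Sum>P\<in>K. P $$ (i,j)) = (1\<^sub>m n :: complex mat) $$ (i,j))"

definition chromatic_number :: "nat \<Rightarrow> complex mat set \<Rightarrow> nat" where
  "chromatic_number n E = (LEAST k. \<exists>K. is_coloring n E K \<and> card K = k)"

definition chi :: "nat \<Rightarrow> nat \<Rightarrow> nat" where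
  "chi n m = Max {chromatic_number n E | E. quantum_graph n m E}"

end

theory Submission
  imports Defs "HOL-Analysis.Function_Topology" "HOL-Analysis.Convex"
begin

text \<open>
  \<^bold>\<open>Upper bound.\<close> Inside the orthogonal complement of the codes found so far, of dimension \<open>p\<close>, pick
  greedily unit vectors that are orthogonal with respect to all forms \<open>\<langle>u, A v\<rangle>\<close>, \<open>A \<in> E\<close>; each new
  vector costs at most \<open>m + 1\<close> linear conditions. Applying Tverberg's theorem to the points given by their
  expectation values, which span an affine space of dimension at most \<open>m\<close>, yields a code of dimension
  \<open>\<lceil>p / (m + 1)\<^sup>2\<rceil>\<close>. Iterating this gives a colouring with \<open>slog n ((m + 1)\<^sup>2)\<close> codes.

  \<^bold>\<open>Lower bound.\<close> Let \<open>E\<close> contain the diagonal operators \<open>A i\<close> (\<open>i < m\<close>) whose \<open>l\<close>-th entry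
  (\<open>l = 0, 1, \<dots>\<close>) is \<open>1 / R\<close> to the power \<open>l\<close> if \<open>l \<equiv> i\<close> modulo \<open>m\<close>, and \<open>0\<close> otherwise, for a huge \<open>R\<close>.
  If codes of total dimension \<open>D < n\<close> have been chosen from a colouring, they cannot exhaust the
  first \<open>D + 1\<close> coordinates, so for some other code and some \<open>i\<close>, \<open>\<epsilon> (A i)\<close> exceeds \<open>1 / R\<close> to the power \<open>D + 1\<close>.
  At most \<open>\<lfloor>D / m\<rfloor> + 1\<close> eigenvalues of \<open>A i\<close> are that large, which bounds the dimension of this code.
  Adding up these dimensions is the reverse of the recursion for \<open>slog n (m + 1)\<close>.
\<close>

section \<open>Tverberg's theorem\<close>

text \<open>Gaussian elimination, one equation at a time: an equation with a nonzero coefficient at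
  \<open>p\<close> is solved for the unknown \<open>p\<close>, which leaves one equation and one
  unknown fewer. Used below over the reals and over the complex numbers.\<close>

lemma homogeneous_system:
  fixes a :: "'j \<Rightarrow> 'i \<Rightarrow> 'a::field"
  assumes "finite J" "finite I" "card J < card I"
  shows "\<exists>c. (\<exists>i\<in>I. c i \<noteq> 0) \<and> (\<forall>j\<in>J. (\<Sum>i\<in>I. a j i * c i) = 0)"
  using assms
proof (induction J arbitrary: I a rule: finite_induct)
  case empty
  then obtain i where "i \<in> I" by (metis card_gt_0_iff ex_in_conv card.empty)
  then show ?case by (intro exI[of _ "\<lambda>_. 1"]) auto
next
  case (insert j J)
  show ?case
  proof (cases "\<forall>i\<in>I. a j i = 0")
    case True
    have "card J < card I" using insert by simp
    from insert.IH[OF insert.prems(1) this, of a] True show ?thesis by auto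
  next
    case False
    then obtain p where p: "p \<in> I" "a j p \<noteq> 0" by auto
    have fin: "finite (I - {p})" and "card J < card (I - {p})"
      using insert p by auto
    from insert.IH[OF this, of "\<lambda>k i. a k i - a k p * a j i / a j p"]
    obtain c where c: "\<exists>i\<in>I - {p}. c i \<noteq> 0"
      "\<And>k. k \<in> J \<Longrightarrow> (\<Sum>i\<in>I - {p}. (a k i - a k p * a j i / a j p) * c i) = 0"
      by blast
    define s where "s = (\<Sum>i\<in>I - {p}. a j i * c i)"
    define c' where "c' = c(p := - s / a j p)"
    have split: "(\<Sum>i\<in>I. a k i * c' i) = (\<Sum>i\<in>I - {p}. a k i * c i) - a k p * s / a j p" for k
      unfolding sum.remove[OF insert.prems(1) p(1)] by (simp add: c'_def)
    have "(\<Sum>i\<in>I. a k i * c' i) = 0" if "k \<in> insert j J" for k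
    proof (cases "k = j")
      case True
      then show ?thesis using p split[of j] by (simp add: s_def)
    next
      case False
      then have "k \<in> J" using that by simp
      from c(2)[OF this] have "(\<Sum>i\<in>I - {p}. a k i * c i) - a k p * s / a j p = 0"
        by (simp add: s_def algebra_simps sum_subtractf sum_distrib_left sum_divide_distrib)
      then show ?thesis using split by simp
    qed
    moreover have "\<exists>i\<in>I. c' i \<noteq> 0" using c(1) by (auto simp: c'_def)
    ultimately show ?thesis by blast
  qed
qed

section \<open>Barany's colourful Caratheodory theorem\<close>

text \<open>Points are functions on the whole index type, which may be infinite, so compactness
  comes from Tychonoff's theorem for the cube over all indices. The sum condition concerns only
  \<open>I\<close>; by \<open>cong\<close> the other coordinates do not influence
  \<open>F\<close>.\<close>

lemma continuous_attains_inf_simplex: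
  fixes F :: "('i \<Rightarrow> real) \<Rightarrow> real"
  assumes "finite I" "I \<noteq> {}" and F: "continuous_on UNIV F"
    and cong: "\<And>x y. (\<And>i. i \<in> I \<Longrightarrow> x i = y i) \<Longrightarrow> F x = F y"
  obtains x where "\<And>i. i \<in> I \<Longrightarrow> x i \<ge> 0" "sum x I = 1"
    "\<And>y. (\<And>i. i \<in> I \<Longrightarrow> y i \<ge> 0) \<Longrightarrow> sum y I = 1 \<Longrightarrow> F x \<le> F y"
proof -
  define B where "B = (Pi\<^sub>E UNIV (\<lambda>_::'i. {0..1::real}))"
  define S where "S = B \<inter> {x. sum x I = 1}"
  have "compactin (product_topology (\<lambda>_. euclidean) UNIV) B"
    unfolding B_def compactin_PiE by simp
  then have "compact B" by (simp add: euclidean_product_topology)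
  moreover have "closed {x::'i \<Rightarrow> real. sum x I = 1}"
    by (intro closed_Collect_eq continuous_on_sum continuous_on_product_coordinates
        continuous_on_const)
  ultimately have cpt: "compact S" unfolding S_def by (rule compact_Int_closed)
  obtain i0 where "i0 \<in> I" using assms(2) by auto
  then have "(\<lambda>i. if i = i0 then 1 else 0) \<in> S"
    using assms(1) by (auto simp: S_def B_def sum.delta)
  then have ne: "S \<noteq> {}" by auto
  obtain x where x: "x \<in> S" "\<And>y. y \<in> S \<Longrightarrow> F x \<le> F y"
    using continuous_attains_inf[OF cpt ne continuous_on_subset[OF F]] by auto
  show thesis
  proof
    show "x i \<ge> 0" for i using x by (auto simp: S_def B_def)
    show "sum x I = 1" using x by (auto simp: S_def)
    fix y assume y: "\<And>i. i \<in> I \<Longrightarrow> y i \<ge> (0::real)" "sum y I = 1"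
    define z where "z = (\<lambda>i. if i \<in> I then y i else 0)"
    have "y i \<le> 1" if "i \<in> I" for i
      using member_le_sum[OF that, of y] y assms(1) by auto
    then have "z \<in> S" using y by (auto simp: S_def B_def z_def)
    then have "F x \<le> F z" by (rule x)
    also have "F z = F y" by (rule cong) (simp add: z_def)
    finally show "F x \<le> F y" .
  qed
qed

text \<open>Among the finitely many colourful choices take one whose convex hull comes closest to
  \<open>0\<close>. If the nearest point \<open>x\<close> were not \<open>0\<close>, some class
  could be left out of a representation of \<open>x\<close>. As \<open>0\<close> lies in the hull of
  that class, the class has a point strictly on the side of \<open>0\<close> of the supporting
  hyperplane at \<open>x\<close>, and swapping it in brings the hull closer.\<close>

lemma colorful_caratheodory:
  fixes p :: "'i \<Rightarrow> 'c \<Rightarrow> 'k \<Rightarrow> real"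
  assumes I: "finite I" and C: "finite C" and K: "finite K" and card: "card K < card I"
    and zero: "\<And>i. i \<in> I \<Longrightarrow> \<exists>g. (\<forall>c\<in>C. g c \<ge> 0) \<and> sum g C = 1 \<and> (\<forall>k\<in>K. (\<Sum>c\<in>C. g c * p i c k) = 0)"
  shows "\<exists>f\<in>I \<rightarrow> C. \<exists>\<alpha>. (\<forall>i\<in>I. \<alpha> i \<ge> 0) \<and> sum \<alpha> I = 1 \<and> (\<forall>k\<in>K. (\<Sum>i\<in>I. \<alpha> i * p i (f i) k) = 0)"
proof -
  define X where "X f \<alpha> k = (\<Sum>i\<in>I. \<alpha> i * p i (f i) k)" for f :: "'i \<Rightarrow> 'c" and \<alpha> k
  define F where "F f \<alpha> = (\<Sum>k\<in>K. (X f \<alpha> k)\<^sup>2)" for f \<alpha>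
  have Ine: "I \<noteq> {}" using card by auto
  have "\<exists>x. (\<forall>i\<in>I. x i \<ge> 0) \<and> sum x I = 1 \<and> (\<forall>y. (\<forall>i\<in>I. y i \<ge> 0) \<longrightarrow> sum y I = 1 \<longrightarrow> F f x \<le> F f y)" for f
  proof -
    have "continuous_on UNIV (F f)"
      unfolding F_def X_def
      by (intro continuous_intros continuous_on_product_coordinates)
    moreover have "F f x = F f y" if "\<And>i. i \<in> I \<Longrightarrow> x i = y i" for x y
      unfolding F_def X_def using that by (simp cong: sum.cong)
    ultimately obtain x where "\<And>i. i \<in> I \<Longrightarrow> x i \<ge> 0" "sum x I = 1"
      "\<And>y. (\<And>i. i \<in> I \<Longrightarrow> y i \<ge> 0) \<Longrightarrow> sum y I = 1 \<Longrightarrow> F f x \<le> F f y"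
      using continuous_attains_inf_simplex[OF I Ine, of "F f"] by blast
    then show ?thesis by blast
  qed
  from choice[OF allI[OF this]]
  obtain a where "\<forall>f. (\<forall>i\<in>I. a f i \<ge> 0) \<and> sum (a f) I = 1
    \<and> (\<forall>y. (\<forall>i\<in>I. y i \<ge> 0) \<longrightarrow> sum y I = 1 \<longrightarrow> F f (a f) \<le> F f y)"
    by (rule exE)
  then have a: "\<And>f i. i \<in> I \<Longrightarrow> a f i \<ge> (0::real)" "\<And>f. sum (a f) I = 1"
    "\<And>f y. (\<And>i. i \<in> I \<Longrightarrow> y i \<ge> 0) \<Longrightarrow> sum y I = 1 \<Longrightarrow> F f (a f) \<le> F f y"
    by auto
  have Cne: "C \<noteq> {}" using zero Ine by fastforce
  then obtain c0 where c0: "c0 \<in> C" by auto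
  \<comment> \<open>Extensional choices are finite in number, so a minimal one exists;
    \<open>best\<close> extends the minimality to arbitrary functions by restriction.\<close>
  have fin: "finite (I \<rightarrow>\<^sub>E C)" using I C by (rule finite_PiE)
  have "(\<lambda>i\<in>I. c0) \<in> I \<rightarrow>\<^sub>E C" using c0 by auto
  then have ne: "I \<rightarrow>\<^sub>E C \<noteq> {}" by blast
  define f where "f = arg_min_on (\<lambda>f. F f (a f)) (I \<rightarrow>\<^sub>E C)"
  have f: "f \<in> I \<rightarrow>\<^sub>E C" "\<And>g. g \<in> I \<rightarrow>\<^sub>E C \<Longrightarrow> F f (a f) \<le> F g (a g)"
    unfolding f_def using arg_min_if_finite(1)[OF fin ne] arg_min_least[OF fin ne, of _ "\<lambda>f. F f (a f)"]
    by auto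
  define x where "x = X f (a f)"
  define nx where "nx = (\<Sum>k\<in>K. (x k)\<^sup>2)"
  have best: "nx \<le> F g y" if "g \<in> I \<rightarrow> C" "\<And>i. i \<in> I \<Longrightarrow> y i \<ge> 0" "sum y I = 1" for g y
  proof -
    have "nx = F f (a f)" by (simp add: nx_def F_def x_def)
    also have "\<dots> \<le> F (restrict g I) (a (restrict g I))" by (rule f(2)) (use that in auto)
    also have "\<dots> \<le> F (restrict g I) y" by (rule a) (use that in auto)
    also have "\<dots> = F g y" by (simp add: F_def X_def cong: sum.cong)
    finally show ?thesis .
  qed
  have "nx = 0"
  proof (rule ccontr)
    assume "nx \<noteq> 0"
    then have nx: "nx > 0" by (simp add: nx_def sum_nonneg less_le)
    \<comment> \<open>Moving from the nearest point \<open>x\<close> towards a point \<open>q\<close> with \<open>\<langle>x, q\<rangle> < \<langle>x, x\<rangle>\<close>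
      decreases the norm.\<close>
    have no_better: "(\<Sum>k\<in>K. x k * q k) \<ge> nx" if
      seg: "\<And>t. 0 < t \<Longrightarrow> t \<le> 1 \<Longrightarrow> nx \<le> (\<Sum>k\<in>K. ((1 - t) * x k + t * q k)\<^sup>2)" for q
    proof (rule ccontr)
      assume less: "\<not> ?thesis"
      define d where "d = nx - (\<Sum>k\<in>K. x k * q k)"
      have d: "d > 0" using less by (simp add: d_def)
      define e where "e = (\<Sum>k\<in>K. (x k - q k)\<^sup>2)"
      have e: "e \<ge> 0" by (simp add: e_def sum_nonneg)
      \<comment> \<open>On the segment the squared norm is \<open>nx - 2 * t * d + t^2 * e\<close>,
        so any \<open>t > 0\<close> with \<open>t * e < 2 * d\<close> gives a decrease; the
        \<open>1\<close> in \<open>e + 1\<close> covers the case \<open>e = 0\<close>.\<close>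
      define t where "t = min 1 (d / (e + 1))"
      have t: "0 < t" "t \<le> 1" using d e by (auto simp: t_def)
      have "t * e < d + d"
      proof -
        have "t * e \<le> d / (e + 1) * e" using e by (intro mult_right_mono) (auto simp: t_def)
        also have "\<dots> \<le> d" using d e by (simp add: field_simps)
        finally show ?thesis using d by simp
      qed
      have "(\<Sum>k\<in>K. ((1 - t) * x k + t * q k)\<^sup>2)
          = (\<Sum>k\<in>K. (x k)\<^sup>2 - 2 * t * ((x k)\<^sup>2 - x k * q k) + t\<^sup>2 * (x k - q k)\<^sup>2)"
        by (intro sum.cong refl) (simp add: power2_eq_square algebra_simps)
      also have "\<dots> = nx - 2 * t * d + t\<^sup>2 * e"
        by (simp add: sum.distrib sum_subtractf nx_def d_def e_def sum_distrib_left[symmetric])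
      also have "\<dots> = nx + t * (t * e - (d + d))" by (simp add: power2_eq_square algebra_simps)
      also have "\<dots> < nx" using t \<open>t * e < d + d\<close> by (simp add: mult_less_0_iff)
      finally show False using seg[OF t] by simp
    qed
    have x_ge: "(\<Sum>k\<in>K. x k * p i (f i) k) \<ge> nx" if i: "i \<in> I" for i
    proof (rule no_better)
      fix t :: real assume t: "0 < t" "t \<le> 1"
      define y where "y j = (1 - t) * a f j + (if j = i then t else 0)" for j
      have "nx \<le> F f y"
        by (rule best) (use f t a i I in \<open>auto simp: y_def sum.distrib sum_distrib_left[symmetric]\<close>)
      moreover have "X f y k = (1 - t) * x k + t * p i (f i) k" for k
      proof -
        have "X f y k = (\<Sum>j\<in>I. (1 - t) * (a f j * p j (f j) k) + (if j = i then t * p i (f i) k else 0))"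
          unfolding X_def y_def by (intro sum.cong refl) (simp add: algebra_simps)
        then show ?thesis using I i by (simp add: sum.distrib sum_distrib_left[symmetric] x_def X_def)
      qed
      ultimately show "nx \<le> (\<Sum>k\<in>K. ((1 - t) * x k + t * p i (f i) k)\<^sup>2)" by (simp add: F_def)
    qed
    have inner_x: "(\<Sum>i\<in>I. b i * (\<Sum>k\<in>K. x k * p i (f i) k)) = (\<Sum>k\<in>K. x k * X f b k)" for b
      unfolding X_def sum_distrib_left
      by (subst sum.swap) (intro sum.cong refl, simp add: algebra_simps)
    \<comment> \<open>\<open>nx\<close> is the average of these inner products with weights
      \<open>a f i\<close>, and none of them is below \<open>nx\<close>.\<close>
    have x_eq: "(\<Sum>k\<in>K. x k * p i (f i) k) = nx" if i: "i \<in> I" "a f i > 0" for i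
    proof (rule ccontr)
      assume "\<not> ?thesis"
      then have "(\<Sum>k\<in>K. x k * p i (f i) k) > nx" using x_ge[OF i(1)] by simp
      then have "(\<Sum>j\<in>I. a f j * nx) < (\<Sum>j\<in>I. a f j * (\<Sum>k\<in>K. x k * p j (f j) k))"
        using i x_ge a(1) I by (intro sum_strict_mono_ex1 bexI[of _ i] ballI mult_left_mono) auto
      also have "\<dots> = (\<Sum>k\<in>K. x k * x k)" unfolding inner_x by (simp add: x_def)
      also have "\<dots> = nx" by (simp add: nx_def power2_eq_square)
      finally show False using a(2)[of f] by (simp add: sum_distrib_right[symmetric])
    qed
    \<comment> \<open>Caratheodory inside the supporting hyperplane: one colour class can be left out.\<close>
    obtain i y where y: "i \<in> I" "y i = 0" "\<And>j. j \<in> I \<Longrightarrow> y j \<ge> 0" "sum y I = 1"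
      "\<And>k. k \<in> K \<Longrightarrow> X f y k = x k"
    proof (cases "\<exists>i\<in>I. a f i = 0")
      case True
      then show thesis using that[of _ "a f"] a by (auto simp: x_def)
    next
      case False
      then have pos: "a f i > 0" if "i \<in> I" for i using a that by (metis less_le)
      obtain b where b: "\<exists>i\<in>I. b i \<noteq> 0" "\<And>k. k \<in> K \<Longrightarrow> (\<Sum>i\<in>I. p i (f i) k * b i) = 0"
        using homogeneous_system[OF K I card, of "\<lambda>k i. p i (f i) k"] by blast
      have bX: "X f b k = 0" if "k \<in> K" for k
        using b(2)[OF that] by (simp add: X_def mult.commute)
      \<comment> \<open>All the chosen points lie on the hyperplane where the inner product with
        \<open>x\<close> is \<open>nx\<close>, so the coefficients of a linear relation between them
        sum to zero.\<close>
      have "nx * sum b I = (\<Sum>i\<in>I. b i * nx)"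
        by (simp add: sum_distrib_left mult.commute)
      also have "\<dots> = (\<Sum>i\<in>I. b i * (\<Sum>k\<in>K. x k * p i (f i) k))"
        by (intro sum.cong refl) (simp add: x_eq pos)
      also have "\<dots> = 0" unfolding inner_x using bX by simp
      finally have sb: "sum b I = 0" using nx by simp
      have "\<exists>i\<in>I. b i > 0"
      proof (rule ccontr)
        assume "\<not> ?thesis"
        then have "\<forall>i\<in>I. - b i \<ge> 0" by auto
        then have "\<forall>i\<in>I. - b i = 0"
          using sb sum_nonneg_eq_0_iff[OF I, of "\<lambda>i. - b i"] by (simp add: sum_negf)
        then show False using b(1) by simp
      qed
      define J where "J = {i\<in>I. b i > 0}"
      have J: "finite J" "J \<noteq> {}" using I \<open>\<exists>i\<in>I. b i > 0\<close> by (auto simp: J_def)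
      \<comment> \<open>Ratio test: \<open>t\<close> is the largest multiple of \<open>b\<close>
        that can be subtracted from the weights without making one negative, and the weight of
        \<open>i\<close> becomes zero.\<close>
      define i where "i = arg_min_on (\<lambda>i. a f i / b i) J"
      have i: "i \<in> I" "b i > 0"
        using arg_min_if_finite(1)[OF J, of "\<lambda>i. a f i / b i"] by (auto simp: i_def J_def)
      define t where "t = a f i / b i"
      have t0: "t \<ge> 0" using i a by (simp add: t_def)
      have tmin: "t \<le> a f j / b j" if "j \<in> I" "b j > 0" for j
        using arg_min_least[OF J, of j "\<lambda>i. a f i / b i"] that by (simp add: t_def i_def J_def)
      define y where "y j = a f j - t * b j" for j
      show thesis
      proof
        show "i \<in> I" by fact
        show "y i = 0" using i by (simp add: y_def t_def)
        show "y j \<ge> 0" if "j \<in> I" for j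
        proof (cases "b j > 0")
          case True
          then show ?thesis using tmin[OF that] by (simp add: y_def field_simps)
        next
          case False
          then have "t * b j \<le> 0" using t0 by (simp add: mult_nonneg_nonpos)
          then show ?thesis using a(1)[OF that, of f] by (simp add: y_def)
        qed
        show "sum y I = 1" using sb a by (simp add: y_def sum_subtractf sum_distrib_left[symmetric])
        show "X f y k = x k" if "k \<in> K" for k
        proof -
          have "X f y k = X f (a f) k - t * X f b k"
            unfolding X_def y_def sum_distrib_left sum_subtractf[symmetric]
            by (intro sum.cong refl) (simp add: algebra_simps)
          then show ?thesis using bX[OF that] by (simp add: x_def)
        qed
      qed
    qed
    obtain g where g: "\<And>c. c \<in> C \<Longrightarrow> g c \<ge> 0" "sum g C = 1" "\<And>k. k \<in> K \<Longrightarrow> (\<Sum>c\<in>C. g c * p i c k) = 0"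
      using zero[OF y(1)] by blast
    have "\<exists>c\<in>C. (\<Sum>k\<in>K. x k * p i c k) < nx"
    proof (rule ccontr)
      assume "\<not> ?thesis"
      then have "(\<Sum>c\<in>C. g c * nx) \<le> (\<Sum>c\<in>C. g c * (\<Sum>k\<in>K. x k * p i c k))"
        using g by (intro sum_mono mult_left_mono) auto
      also have "\<dots> = (\<Sum>k\<in>K. x k * (\<Sum>c\<in>C. g c * p i c k))"
        unfolding sum_distrib_left by (subst sum.swap) (intro sum.cong refl, simp add: algebra_simps)
      also have "\<dots> = 0" using g by simp
      finally show False using g nx by (simp add: sum_distrib_right[symmetric])
    qed
    then obtain c where c: "c \<in> C" "(\<Sum>k\<in>K. x k * p i c k) < nx" by auto
    have "(\<Sum>k\<in>K. x k * p i c k) \<ge> nx"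
    proof (rule no_better)
      fix t :: real assume t: "0 < t" "t \<le> 1"
      \<comment> \<open>As \<open>y i = 0\<close>, exchanging the point of class \<open>i\<close>
        for \<open>c\<close> does not move \<open>x\<close>. The segment from \<open>x\<close> to
        the new point thus consists of colourful combinations, and \<open>no_better\<close>
        applies.\<close>
      define z where "z j = (1 - t) * y j + (if j = i then t else 0)" for j
      have "nx \<le> F (f(i := c)) z"
        by (rule best) (use f t y c I in \<open>auto simp: z_def sum.distrib sum_distrib_left[symmetric]\<close>)
      moreover have "X (f(i := c)) z k = (1 - t) * x k + t * p i c k" if "k \<in> K" for k
      proof -
        have "X (f(i := c)) z k = (\<Sum>j\<in>I. (1 - t) * (y j * p j (f j) k) + (if j = i then t * p i c k else 0))"
          unfolding X_def z_def using y(2) by (intro sum.cong refl) (auto simp: algebra_simps)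
        then show ?thesis using I y(1) y(5)[OF that]
          by (simp add: sum.distrib sum_distrib_left[symmetric] X_def)
      qed
      ultimately show "nx \<le> (\<Sum>k\<in>K. ((1 - t) * x k + t * p i c k)\<^sup>2)" by (simp add: F_def)
    qed
    then show False using c by simp
  qed
  then have "\<forall>k\<in>K. x k = 0" using K by (simp add: nx_def sum_nonneg_eq_0_iff)
  then have "(\<Sum>i\<in>I. a f i * p i (f i) k) = 0" if "k \<in> K" for k
    using that by (simp add: x_def X_def)
  moreover have "f \<in> I \<rightarrow> C" using f(1) by (simp add: PiE_def)
  ultimately show ?thesis
    using a(1)[of _ f] a(2)[of f] by (intro bexI[of _ f] exI[of _ "a f"] conjI ballI)
qed

text \<open>Sarkaria's tensor trick: with \<open>z 0 + \<dots> + z (r - 1) = 0\<close> the only linear relation between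
  \<open>z 0, \<dots>, z (r - 1)\<close>, the colour classes \<open>{y i \<otimes> z c | c < r}\<close> have \<open>0\<close> in their convex hulls,
  and a colourful convex combination of \<open>0\<close> is a Tverberg partition.\<close>
lemma tverberg_in_hyperplane:
  fixes y :: "nat \<Rightarrow> nat \<Rightarrow> real" and l :: "nat \<Rightarrow> real"
  assumes r: "r \<ge> 1" and N: "(r - 1) * d < N"
    and l: "\<And>i. i < N \<Longrightarrow> (\<Sum>k<d. l k * y i k) = 1"
  shows "\<exists>f \<alpha> x. (\<forall>i<N. f i < r) \<and> (\<forall>i<N. \<alpha> i \<ge> 0) \<and>
    (\<forall>c<r. (\<Sum>i | i < N \<and> f i = c. \<alpha> i) = (1::real)) \<and>
    (\<forall>c<r. \<forall>k<d. (\<Sum>i | i < N \<and> f i = c. \<alpha> i * y i k) = x k)"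
proof -
  \<comment> \<open>In dimension \<open>r - 1\<close>: the standard basis vectors and, at
    \<open>c = r - 1\<close>, minus their sum. The tensors therefore need only
    \<open>(r - 1) * d\<close> coordinates.\<close>
  define z where "z c j = (if c = r - 1 then - 1 else if c = j then 1 else (0::real))" for c j :: nat
  have zero: "\<exists>g. (\<forall>c\<in>{..<r}. g c \<ge> 0) \<and> sum g {..<r} = 1
    \<and> (\<forall>k\<in>{..<r - 1} \<times> {..<d}. (\<Sum>c<r. g c * (z c (fst k) * y i (snd k))) = 0)" for i
  proof (intro exI[of _ "\<lambda>_. 1 / r"] conjI ballI)
    show "(\<Sum>c<r. 1 / real r) = 1" using r by simp
  next
    fix k :: "nat \<times> nat" assume "k \<in> {..<r - 1} \<times> {..<d}"
    moreover obtain q where q: "r = Suc q" using r by (cases r) auto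
    ultimately have "(\<Sum>c<r. z c (fst k)) = 0" by (auto simp: z_def sum.delta)
    then show "(\<Sum>c<r. 1 / real r * (z c (fst k) * y i (snd k))) = 0"
      by (simp add: sum_divide_distrib[symmetric] sum_distrib_right[symmetric])
  qed simp
  have "card ({..<r - 1} \<times> {..<d}) < card {..<N}" using N by simp
  then have "\<exists>f\<in>{..<N} \<rightarrow> {..<r}. \<exists>a. (\<forall>i\<in>{..<N}. a i \<ge> 0) \<and> sum a {..<N} = 1
    \<and> (\<forall>k\<in>{..<r - 1} \<times> {..<d}. (\<Sum>i<N. a i * (z (f i) (fst k) * y i (snd k))) = 0)"
    using zero by (intro colorful_caratheodory) simp_all
  then obtain f a where f: "f \<in> {..<N} \<rightarrow> {..<r}"
    and a: "\<forall>i\<in>{..<N}. a i \<ge> 0" "sum a {..<N} = 1"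
    and k: "\<forall>k\<in>{..<r - 1} \<times> {..<d}. (\<Sum>i<N. a i * (z (f i) (fst k) * y i (snd k))) = 0"
    by (elim bexE exE conjE)
  have comb: "(\<Sum>i<N. a i * (z (f i) j * y i k)) = 0" if "j < r - 1" "k < d" for j k
    using bspec[OF k, of "(j, k)"] that by simp
  define Y where "Y c k = (\<Sum>i | i < N \<and> f i = c. a i * y i k)" for c k
  have Y_if: "Y c k = (\<Sum>i<N. if f i = c then a i * y i k else 0)" for c k
    unfolding Y_def by (subst sum.inter_filter[symmetric]) auto
  have Y_eq: "Y c k = Y (r - 1) k" if "c < r" "k < d" for c k
  proof (cases "c = r - 1")
    case False
    then have "c < r - 1" using that by simp
    have "Y c k - Y (r - 1) k = (\<Sum>i<N. a i * (z (f i) c * y i k))"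
      unfolding Y_if sum_subtractf[symmetric]
      using \<open>c < r - 1\<close> by (intro sum.cong refl) (auto simp: z_def)
    then show ?thesis using comb[OF \<open>c < r - 1\<close> that(2)] by simp
  qed simp
  \<comment> \<open>The functional \<open>l\<close> is \<open>1\<close> at every \<open>y i\<close>,
    so the total weight of a part can be computed from its weighted sum \<open>Y c\<close>. Equal
    sums force equal weights, hence \<open>1 / r\<close> each, and scaling by \<open>r\<close> makes
    the combinations convex.\<close>
  define s where "s c = (\<Sum>i | i < N \<and> f i = c. a i)" for c
  have s_Y: "s c = (\<Sum>k<d. l k * Y c k)" for c
  proof -
    have "(\<Sum>k<d. l k * Y c k) = (\<Sum>i | i < N \<and> f i = c. a i * (\<Sum>k<d. l k * y i k))"
      unfolding Y_def sum_distrib_left by (subst sum.swap) (intro sum.cong refl, simp add: algebra_simps)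
    also have "\<dots> = s c" unfolding s_def using l by (intro sum.cong refl) auto
    finally show ?thesis by simp
  qed
  have s_eq: "s c = s (r - 1)" if "c < r" for c
    unfolding s_Y using Y_eq[OF that] by (intro sum.cong refl) auto
  have "1 = sum a {..<N}" using a by simp
  also have "\<dots> = (\<Sum>c<r. sum a {i \<in> {..<N}. f i = c})"
    by (rule sum.group[symmetric]) (use f in auto)
  also have "\<dots> = (\<Sum>c<r. s (r - 1))"
  proof (intro sum.cong refl)
    fix c assume "c \<in> {..<r}"
    then show "sum a {i \<in> {..<N}. f i = c} = s (r - 1)"
      using s_eq[of c] by (simp add: s_def)
  qed
  finally have "s (r - 1) = 1 / r" using r by (simp add: field_simps)
  then have s: "s c = 1 / r" if "c < r" for c using s_eq[OF that] by simp
  show ?thesis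
  proof (rule exI[of _ f], rule exI[of _ "\<lambda>i. r * a i"], rule exI[of _ "\<lambda>k. r * Y (r - 1) k"],
      intro conjI allI impI)
    show "(\<Sum>i | i < N \<and> f i = c. real r * a i) = 1" if "c < r" for c
      using s[OF that] r by (simp add: s_def sum_distrib_left[symmetric])
    show "(\<Sum>i | i < N \<and> f i = c. real r * a i * y i k) = real r * Y (r - 1) k"
      if "c < r" "k < d" for c k
      using Y_eq[OF that] by (simp add: Y_def mult.assoc sum_distrib_left[symmetric])
    show "f i < r" if "i < N" for i using f that by auto
    show "real r * a i \<ge> 0" if "i < N" for i using a(1) that by simp
  qed
qed

section \<open>Orthonormal families and projections\<close>

text \<open>Vectors are plain functions of which only the values below \<open>n\<close> count, so
  that linear combinations are lambda terms free of carrier conditions.\<close>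

definition ip :: "nat \<Rightarrow> (nat \<Rightarrow> complex) \<Rightarrow> (nat \<Rightarrow> complex) \<Rightarrow> complex" where
  "ip n u v = (\<Sum>i<n. cnj (u i) * v i)"

definition form :: "nat \<Rightarrow> complex mat \<Rightarrow> (nat \<Rightarrow> complex) \<Rightarrow> (nat \<Rightarrow> complex) \<Rightarrow> complex" where
  "form n A u v = (\<Sum>i<n. \<Sum>j<n. cnj (u i) * A $$ (i, j) * v j)"

definition orthonormal :: "nat \<Rightarrow> 'x set \<Rightarrow> ('x \<Rightarrow> nat \<Rightarrow> complex) \<Rightarrow> bool" where
  "orthonormal n X w \<longleftrightarrow> (\<forall>x\<in>X. \<forall>y\<in>X. ip n (w x) (w y) = (if x = y then 1 else 0))"

definition proj_of :: "nat \<Rightarrow> 'x set \<Rightarrow> ('x \<Rightarrow> nat \<Rightarrow> complex) \<Rightarrow> complex mat" where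
  "proj_of n X w = mat n n (\<lambda>(i, j). \<Sum>x\<in>X. w x i * cnj (w x j))"

lemma orthonormalD:
  "orthonormal n X w \<Longrightarrow> x \<in> X \<Longrightarrow> y \<in> X \<Longrightarrow> ip n (w x) (w y) = (if x = y then 1 else 0)"
  by (simp add: orthonormal_def)

lemma proj_of_carrier [simp]: "proj_of n X w \<in> carrier_mat n n"
  by (simp add: proj_of_def)

lemma proj_of_dim [simp]: "dim_row (proj_of n X w) = n" "dim_col (proj_of n X w) = n"
  by (simp_all add: proj_of_def)

lemma proj_of_index [simp]:
  "i < n \<Longrightarrow> j < n \<Longrightarrow> proj_of n X w $$ (i, j) = (\<Sum>x\<in>X. w x i * cnj (w x j))"
  by (simp add: proj_of_def)

lemma proj_of_apply:
  assumes "i < n"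
  shows "(\<Sum>j<n. proj_of n X w $$ (i, j) * v j) = (\<Sum>x\<in>X. w x i * ip n (w x) v)"
proof -
  have "(\<Sum>j<n. proj_of n X w $$ (i, j) * v j) = (\<Sum>j<n. \<Sum>x\<in>X. w x i * (cnj (w x j) * v j))"
    using assms by (intro sum.cong refl) (simp add: sum_distrib_right mult.assoc)
  also have "\<dots> = (\<Sum>x\<in>X. \<Sum>j<n. w x i * (cnj (w x j) * v j))" by (rule sum.swap)
  finally show ?thesis by (simp add: ip_def sum_distrib_left)
qed

lemma mat_adjoint_index:
  assumes "A \<in> carrier_mat n n" "i < n" "j < n"
  shows "mat_adjoint A $$ (i, j) = cnj (A $$ (j, i))"
  using assms by (simp add: mat_adjoint_def mat_of_rows_index)

lemma mat_adjoint_carrier: "A \<in> carrier_mat n n \<Longrightarrow> mat_adjoint A \<in> carrier_mat n n"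
  by (auto simp: mat_adjoint_def)

lemma mat_mult_index:
  assumes "A \<in> carrier_mat n n" "B \<in> carrier_mat n n" "i < n" "j < n"
  shows "(A * B) $$ (i, j) = (\<Sum>k<n. A $$ (i, k) * B $$ (k, j))"
  using assms by (simp add: scalar_prod_def lessThan_atLeast0)

lemma ip_cnj: "cnj (ip n u v) = ip n v u"
  by (simp add: ip_def mult.commute)

lemma ip_self: "ip n v v = complex_of_real (\<Sum>i<n. (cmod (v i))\<^sup>2)"
  unfolding ip_def of_real_sum
  by (intro sum.cong refl) (metis complex_norm_square mult.commute of_real_power)

lemma ip_sum_right: "ip n u (\<lambda>i. \<Sum>x\<in>X. c x * w x i) = (\<Sum>x\<in>X. c x * ip n u (w x))"
  unfolding ip_def sum_distrib_left
  by (subst sum.swap) (intro sum.cong refl, simp add: algebra_simps)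

lemma ip_sum_left: "ip n (\<lambda>i. \<Sum>x\<in>X. c x * w x i) v = (\<Sum>x\<in>X. cnj (c x) * ip n (w x) v)"
proof -
  have "ip n (\<lambda>i. \<Sum>x\<in>X. c x * w x i) v = cnj (ip n v (\<lambda>i. \<Sum>x\<in>X. c x * w x i))"
    by (simp add: ip_cnj)
  also have "\<dots> = (\<Sum>x\<in>X. cnj (c x) * ip n (w x) v)"
    unfolding ip_sum_right by (simp add: ip_cnj)
  finally show ?thesis .
qed

lemma form_ip: "form n A u v = ip n u (\<lambda>i. \<Sum>j<n. v j * A $$ (i, j))"
  unfolding form_def ip_def sum_distrib_left by (intro sum.cong refl) (simp add: algebra_simps)

lemma form_sum_right:
  "form n A u (\<lambda>i. \<Sum>x\<in>X. c x * w x i) = (\<Sum>x\<in>X. c x * form n A u (w x))"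
proof -
  have "form n A u (\<lambda>i. \<Sum>x\<in>X. c x * w x i)
      = ip n u (\<lambda>i. \<Sum>x\<in>X. c x * (\<Sum>j<n. w x j * A $$ (i, j)))"
    unfolding form_ip sum_distrib_right sum_distrib_left
    by (intro arg_cong[where f = "ip n u"] ext, subst sum.swap)
      (intro sum.cong refl, simp add: algebra_simps)
  then show ?thesis unfolding ip_sum_right form_ip .
qed

lemma form_sum_left:
  "form n A (\<lambda>i. \<Sum>x\<in>X. c x * w x i) v = (\<Sum>x\<in>X. cnj (c x) * form n A (w x) v)"
  unfolding form_ip ip_sum_left ..

lemma form_one: "form n (1\<^sub>m n) u v = ip n u v"
proof -
  have "(\<Sum>j<n. cnj (u i) * 1\<^sub>m n $$ (i, j) * v j) = cnj (u i) * v i" if "i < n" for i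
  proof -
    have "(\<Sum>j<n. cnj (u i) * 1\<^sub>m n $$ (i, j) * v j) = (\<Sum>j<n. if i = j then cnj (u i) * v i else 0)"
      using that by (intro sum.cong refl) auto
    then show ?thesis using that by simp
  qed
  then show ?thesis by (simp add: form_def ip_def)
qed

lemma form_self_adjoint:
  assumes "self_adjoint n A"
  shows "cnj (form n A u v) = form n A v u"
proof -
  have sym: "cnj (A $$ (i, j)) = A $$ (j, i)" if "i < n" "j < n" for i j
    using assms mat_adjoint_index[of A n j i] that by (auto simp: self_adjoint_def)
  have "cnj (form n A u v) = (\<Sum>i<n. \<Sum>j<n. cnj (v j) * A $$ (j, i) * u i)"
    unfolding form_def cnj_sum by (intro sum.cong refl) (simp add: sym)
  then show ?thesis unfolding form_def by (subst sum.swap)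
qed

lemma form_real_lincomb:
  "form n (real_lincomb n c bs) u v = (\<Sum>k<length bs. complex_of_real (c k) * form n (bs ! k) u v)"
proof -
  have "form n (real_lincomb n c bs) u v = (\<Sum>i<n. \<Sum>j<n. \<Sum>k<length bs.
      complex_of_real (c k) * (cnj (u i) * (bs ! k) $$ (i, j) * v j))"
    unfolding form_def real_lincomb_def
    by (intro sum.cong refl) (simp add: sum_distrib_left sum_distrib_right algebra_simps)
  also have "\<dots> = (\<Sum>i<n. \<Sum>k<length bs. \<Sum>j<n.
      complex_of_real (c k) * (cnj (u i) * (bs ! k) $$ (i, j) * v j))"
    by (rule sum.cong[OF refl], rule sum.swap)
  also have "\<dots> = (\<Sum>k<length bs. \<Sum>i<n. \<Sum>j<n.
      complex_of_real (c k) * (cnj (u i) * (bs ! k) $$ (i, j) * v j))"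
    by (rule sum.swap)
  finally show ?thesis by (simp add: form_def sum_distrib_left)
qed

lemma ip_scale: "ip n u (\<lambda>i. c * v i) = c * ip n u v" "ip n (\<lambda>i. c * u i) v = cnj c * ip n u v"
  by (simp_all add: ip_def sum_distrib_left algebra_simps)

lemma normalize_vector:
  assumes "i < n" "v i \<noteq> 0"
  shows "\<exists>t. ip n (\<lambda>i. t * v i) (\<lambda>i. t * v i) = 1"
proof -
  define s where "s = (\<Sum>i<n. (cmod (v i))\<^sup>2)"
  have s: "s > 0" unfolding s_def by (rule sum_pos2[of _ i]) (use assms in auto)
  define t where "t = 1 / sqrt s"
  have "t * t * s = 1" using s by (simp add: t_def)
  then have "complex_of_real t * (complex_of_real t * complex_of_real s) = 1"
    by (metis mult.assoc of_real_1 of_real_mult)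
  then show ?thesis
    by (intro exI[of _ "complex_of_real t"]) (simp only: ip_scale ip_self s_def[symmetric] complex_cnj_complex_of_real)
qed

lemma unit_vector_exists:
  assumes "finite J" "card J < n"
  shows "\<exists>v. ip n v v = 1 \<and> (\<forall>j\<in>J. ip n (a j) v = 0)"
proof -
  obtain c where c: "\<exists>i<n. c i \<noteq> 0" "\<And>j. j \<in> J \<Longrightarrow> (\<Sum>i<n. cnj (a j i) * c i) = 0"
    using homogeneous_system[of J "{..<n}" "\<lambda>j i. cnj (a j i)"] assms by auto
  then obtain t where "ip n (\<lambda>i. t * c i) (\<lambda>i. t * c i) = 1" using normalize_vector by blast
  moreover have "ip n (a j) (\<lambda>i. t * c i) = 0" if "j \<in> J" for j
    unfolding ip_scale using c(2)[OF that] by (simp add: ip_def)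
  ultimately show ?thesis by blast
qed

lemma orthonormal_comb_norm:
  assumes "finite X" "orthonormal n X w"
  shows "ip n (\<lambda>i. \<Sum>x\<in>X. c x * w x i) (\<lambda>i. \<Sum>x\<in>X. c x * w x i)
    = complex_of_real (\<Sum>x\<in>X. (cmod (c x))\<^sup>2)"
proof -
  have "ip n (\<lambda>i. \<Sum>x\<in>X. c x * w x i) (\<lambda>i. \<Sum>x\<in>X. c x * w x i)
      = (\<Sum>x\<in>X. \<Sum>y\<in>X. if x = y then c x * cnj (c x) else 0)"
    unfolding ip_sum_right ip_sum_left sum_distrib_left
    by (intro sum.cong refl) (use assms in \<open>auto simp: orthonormal_def\<close>)
  also have "\<dots> = (\<Sum>x\<in>X. c x * cnj (c x))" using assms(1) by simp
  finally show ?thesis unfolding of_real_sum complex_norm_square .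
qed

lemma orthonormal_card_le:
  assumes "finite X" "orthonormal n X w"
  shows "card X \<le> n"
proof (rule ccontr)
  assume "\<not> card X \<le> n"
  then obtain c where c: "\<exists>x\<in>X. c x \<noteq> 0" "\<And>i. i < n \<Longrightarrow> (\<Sum>x\<in>X. w x i * c x) = 0"
    using homogeneous_system[of "{..<n}" X "\<lambda>i x. w x i"] assms(1) by auto
  have "ip n (\<lambda>i. \<Sum>x\<in>X. c x * w x i) (\<lambda>i. \<Sum>x\<in>X. c x * w x i) = 0"
    unfolding ip_def using c(2) by (intro sum.neutral ballI) (simp add: mult.commute[of "c _"])
  then have "(\<Sum>x\<in>X. (cmod (c x))\<^sup>2) = 0"
    unfolding orthonormal_comb_norm[OF assms] of_real_eq_0_iff .
  then show False using c(1) assms(1) by (auto simp: sum_nonneg_eq_0_iff)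
qed

text \<open>\<open>r\<close> is the \<open>j\<close>-th standard basis vector minus its projection
  to the family, hence orthogonal to all \<open>w x\<close>. If it were nonzero, normalizing it
  would yield \<open>n + 1\<close> orthonormal vectors; the option type supplies the extra
  index.\<close>

lemma orthonormal_complete:
  assumes X: "finite X" "orthonormal n X w" "card X = n" and ij: "i < n" "j < n"
  shows "(\<Sum>x\<in>X. w x i * cnj (w x j)) = (if i = j then 1 else 0)"
proof -
  define r where "r k = (if k = j then 1 else 0) - (\<Sum>x\<in>X. cnj (w x j) * w x k)" for k
  have ip_delta: "ip n u (\<lambda>k. if k = j then 1 else 0) = cnj (u j)" for u
  proof -
    have "ip n u (\<lambda>k. if k = j then 1 else 0) = (\<Sum>k<n. if k = j then cnj (u j) else 0)"
      unfolding ip_def by (intro sum.cong refl) auto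
    then show ?thesis using ij by simp
  qed
  have r_orth: "ip n (w x) r = 0" if "x \<in> X" for x
  proof -
    have "ip n (w x) r = ip n (w x) (\<lambda>k. if k = j then 1 else 0)
        - ip n (w x) (\<lambda>k. \<Sum>x\<in>X. cnj (w x j) * w x k)"
      unfolding r_def ip_def right_diff_distrib sum_subtractf ..
    also have "\<dots> = cnj (w x j) - (\<Sum>y\<in>X. if x = y then cnj (w x j) else 0)"
      unfolding ip_delta ip_sum_right using that X(2)
      by (intro arg_cong2[of _ _ _ _ minus] sum.cong refl) (auto simp: orthonormal_def)
    finally show ?thesis using that X(1) by simp
  qed
  have "r k = 0" if "k < n" for k
  proof (rule ccontr)
    assume "r k \<noteq> 0"
    then obtain t where t: "ip n (\<lambda>i. t * r i) (\<lambda>i. t * r i) = 1"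
      using normalize_vector \<open>k < n\<close> by blast
    define w' where "w' x = (case x of None \<Rightarrow> (\<lambda>i. t * r i) | Some x \<Rightarrow> w x)" for x
    have "ip n (w' None) (w' None) = 1" using t by (simp add: w'_def)
    moreover have "ip n (w' (Some x)) (w' None) = 0" "ip n (w' None) (w' (Some x)) = 0" if "x \<in> X" for x
      using r_orth[OF that] ip_cnj[of n "w x" r] by (simp_all add: w'_def ip_scale)
    moreover have "ip n (w' (Some x)) (w' (Some y)) = (if x = y then 1 else 0)" if "x \<in> X" "y \<in> X" for x y
      using that X(2) by (simp add: w'_def orthonormal_def)
    ultimately have "orthonormal n (insert None (Some ` X)) w'"
      by (auto simp: orthonormal_def)
    from orthonormal_card_le[OF _ this] X show False
      by (simp add: card_image)
  qed
  from this[OF ij(1)] show ?thesis by (simp add: r_def mult.commute split: if_splits)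
qed

lemma proj_sandwich_index:
  assumes A: "A \<in> carrier_mat n n" and ij: "i < n" "j < n"
  shows "(proj_of n X w * A * proj_of n Y v) $$ (i, j)
    = (\<Sum>x\<in>X. \<Sum>y\<in>Y. w x i * form n A (w x) (v y) * cnj (v y j))"
proof -
  have "(proj_of n X w * A * proj_of n Y v) $$ (i, j)
      = (\<Sum>l<n. (\<Sum>k<n. (\<Sum>x\<in>X. w x i * cnj (w x k)) * A $$ (k, l)) * (\<Sum>y\<in>Y. v y l * cnj (v y j)))"
    unfolding mat_mult_index[OF mult_carrier_mat[OF proj_of_carrier A] proj_of_carrier ij]
    using ij by (intro sum.cong refl) (simp add: mat_mult_index[OF proj_of_carrier A] del: index_mult_mat)
  also have "\<dots> = (\<Sum>l<n. \<Sum>k<n. \<Sum>x\<in>X. \<Sum>y\<in>Y. w x i * (cnj (w x k) * A $$ (k, l) * v y l) * cnj (v y j))"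
    by (simp add: sum_distrib_left sum_distrib_right algebra_simps)
  also have "\<dots> = (\<Sum>k<n. \<Sum>l<n. \<Sum>x\<in>X. \<Sum>y\<in>Y. w x i * (cnj (w x k) * A $$ (k, l) * v y l) * cnj (v y j))"
    by (rule sum.swap)
  also have "\<dots> = (\<Sum>k<n. \<Sum>x\<in>X. \<Sum>l<n. \<Sum>y\<in>Y. w x i * (cnj (w x k) * A $$ (k, l) * v y l) * cnj (v y j))"
    by (rule sum.cong[OF refl], rule sum.swap)
  also have "\<dots> = (\<Sum>x\<in>X. \<Sum>k<n. \<Sum>l<n. \<Sum>y\<in>Y. w x i * (cnj (w x k) * A $$ (k, l) * v y l) * cnj (v y j))"
    by (rule sum.swap)
  also have "\<dots> = (\<Sum>x\<in>X. \<Sum>k<n. \<Sum>y\<in>Y. \<Sum>l<n. w x i * (cnj (w x k) * A $$ (k, l) * v y l) * cnj (v y j))"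
    by (rule sum.cong[OF refl], rule sum.cong[OF refl], rule sum.swap)
  also have "\<dots> = (\<Sum>x\<in>X. \<Sum>y\<in>Y. \<Sum>k<n. \<Sum>l<n. w x i * (cnj (w x k) * A $$ (k, l) * v y l) * cnj (v y j))"
    by (rule sum.cong[OF refl], rule sum.swap)
  finally show ?thesis by (simp add: form_def sum_distrib_left sum_distrib_right)
qed

lemma orth_proj_proj_of:
  assumes "finite X" "orthonormal n X w"
  shows "orth_proj n (proj_of n X w)"
proof -
  have "proj_of n X w * proj_of n X w = proj_of n X w"
  proof (rule eq_matI)
    fix i j assume "i < dim_row (proj_of n X w)" "j < dim_col (proj_of n X w)"
    then have ij: "i < n" "j < n" by auto
    have "proj_of n X w * proj_of n X w = proj_of n X w * 1\<^sub>m n * proj_of n X w" by simp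
    then have "(proj_of n X w * proj_of n X w) $$ (i, j)
        = (\<Sum>x\<in>X. \<Sum>y\<in>X. w x i * ip n (w x) (w y) * cnj (w y j))"
      using proj_sandwich_index[OF one_carrier_mat ij, of X w X w] by (simp add: form_one)
    also have "\<dots> = (\<Sum>x\<in>X. \<Sum>y\<in>X. if x = y then w x i * cnj (w x j) else 0)"
      using assms(2) by (intro sum.cong refl) (auto simp: orthonormal_def)
    finally show "(proj_of n X w * proj_of n X w) $$ (i, j) = proj_of n X w $$ (i, j)"
      using ij assms(1) by simp
  qed auto
  moreover have "mat_adjoint (proj_of n X w) = proj_of n X w"
    by (rule eq_matI)
      (use mat_adjoint_carrier[OF proj_of_carrier, of n X w] in
        \<open>auto simp: mat_adjoint_index[OF proj_of_carrier] mult.commute\<close>)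
  ultimately show ?thesis by (simp add: orth_proj_def)
qed

lemma is_code_proj_of:
  assumes "finite X" "orthonormal n X w" and E: "\<And>A. A \<in> E \<Longrightarrow> A \<in> carrier_mat n n"
    and eps: "\<And>A x y. A \<in> E \<Longrightarrow> x \<in> X \<Longrightarrow> y \<in> X \<Longrightarrow>
      form n A (w x) (w y) = (if x = y then complex_of_real (\<epsilon> A) else 0)"
  shows "is_code n E (proj_of n X w)"
proof -
  have "proj_of n X w * A * proj_of n X w = complex_of_real (\<epsilon> A) \<cdot>\<^sub>m proj_of n X w" if "A \<in> E" for A
  proof (rule eq_matI)
    fix i j assume "i < dim_row (complex_of_real (\<epsilon> A) \<cdot>\<^sub>m proj_of n X w)"
      "j < dim_col (complex_of_real (\<epsilon> A) \<cdot>\<^sub>m proj_of n X w)"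
    then have ij: "i < n" "j < n" by auto
    have "(proj_of n X w * A * proj_of n X w) $$ (i, j)
        = (\<Sum>x\<in>X. \<Sum>y\<in>X. if x = y then \<epsilon> A * (w x i * cnj (w x j)) else 0)"
      unfolding proj_sandwich_index[OF E[OF that] ij]
      by (intro sum.cong refl) (auto simp: eps[OF that])
    then show "(proj_of n X w * A * proj_of n X w) $$ (i, j)
        = (complex_of_real (\<epsilon> A) \<cdot>\<^sub>m proj_of n X w) $$ (i, j)"
      using ij assms(1) by (simp add: sum_distrib_left)
  qed (use E[OF that] in auto)
  then show ?thesis unfolding is_code_def using orth_proj_proj_of[OF assms(1,2)] by blast
qed

section \<open>The greedy colouring\<close>

lemma quantum_graphE:
  assumes "quantum_graph n m E"
  obtains bs c0 where "length bs = m + 1" "E = {real_lincomb n c bs | c. True}"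
    "\<And>k. k < m + 1 \<Longrightarrow> self_adjoint n (bs ! k)" "1\<^sub>m n = real_lincomb n c0 bs"
proof -
  from assms obtain bs where bs: "length bs = m + 1" "set bs \<subseteq> carrier_mat n n"
    "E = {real_lincomb n c bs | c. True}"
    unfolding quantum_graph_def real_space_dim_def by blast
  have "self_adjoint n (bs ! k)" if k: "k < m + 1" for k
  proof -
    have "bs ! k \<in> carrier_mat n n" using bs k by auto
    then have "bs ! k = real_lincomb n (\<lambda>j. if j = k then 1 else 0) bs"
      using k bs(1) by (intro eq_matI) (auto simp: real_lincomb_def if_distrib[of complex_of_real] if_distrib[of "\<lambda>x. x * _"] cong: if_cong)
    then show ?thesis using assms bs(3) unfolding quantum_graph_def by blast
  qed
  moreover obtain c0 where "1\<^sub>m n = real_lincomb n c0 bs"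
    using assms bs(3) unfolding quantum_graph_def by blast
  ultimately show thesis using that[OF bs(1,3)] by blast
qed

text \<open>The next vector has to meet \<open>card X\<close> conditions from \<open>w\<close> and
  \<open>d\<close> from each earlier vector, and fewer than \<open>n\<close> conditions can be met.
  The last vector constrains no successor, hence \<open>N - 1\<close>. Only pairs
  \<open>s' < s\<close> are treated; self-adjointness gives the other order later.\<close>

lemma greedy_orthogonal_vectors:
  fixes bs :: "nat \<Rightarrow> complex mat"
  assumes "finite X"
  shows "N = 0 \<or> card X + (N - 1) * d < n \<Longrightarrow>
    \<exists>v. \<forall>s<N. ip n (v s) (v s) = 1 \<and> (\<forall>x\<in>X. ip n (w x) (v s) = 0) \<and>
      (\<forall>s'<s. \<forall>k<d. form n (bs k) (v s') (v s) = 0)"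
proof (induction N)
  case (Suc N)
  then have bound: "card X + N * d < n" by simp
  then have "N = 0 \<or> card X + (N - 1) * d < n"
    by (cases N) auto
  from Suc.IH[OF this] obtain v where v: "\<And>s. s < N \<Longrightarrow> ip n (v s) (v s) = 1"
    "\<And>s x. s < N \<Longrightarrow> x \<in> X \<Longrightarrow> ip n (w x) (v s) = 0"
    "\<And>s s' k. s < N \<Longrightarrow> s' < s \<Longrightarrow> k < d \<Longrightarrow> form n (bs k) (v s') (v s) = 0"
    by blast
  \<comment> \<open>\<open>Inl\<close> lists the given vectors; \<open>Inr (s, k)\<close> is the
    vector orthogonality to which expresses the vanishing of
    \<open>form n (bs k) (v s)\<close>.\<close>
  define a where "a j = (case j of Inl x \<Rightarrow> w x
    | Inr (s, k) \<Rightarrow> (\<lambda>j. cnj (\<Sum>i<n. cnj (v s i) * bs k $$ (i, j))))" for j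
  have a_form: "ip n (a (Inr (s, k))) u = form n (bs k) (v s) u" for s k u
    unfolding a_def ip_def form_def by (simp add: sum_distrib_right) (rule sum.swap)
  have "finite (X <+> {..<N} \<times> {..<d})" "card (X <+> {..<N} \<times> {..<d}) < n"
    using assms bound by (simp_all add: card_Plus)
  from unit_vector_exists[OF this, of a] obtain u where u: "ip n u u = 1"
    "\<And>j. j \<in> X <+> {..<N} \<times> {..<d} \<Longrightarrow> ip n (a j) u = 0"
    by blast
  have uX: "ip n (w x) u = 0" if "x \<in> X" for x
    using u(2)[of "Inl x"] that by (auto simp: a_def)
  have uv: "form n (bs k) (v s) u = 0" if "s < N" "k < d" for s k
    using u(2)[of "Inr (s, k)"] that by (auto simp: a_form)
  show ?case
    by (rule exI[of _ "v(N := u)"]) (use v u(1) uX uv in \<open>auto simp: less_Suc_eq\<close>)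
qed simp

text \<open>Two index sets are allowed so that disjoint parts yield orthogonality, while equal ones
  yield the average of the values at the \<open>v s\<close> with weights
  \<open>|c s|^2\<close>.\<close>

lemma form_comb_diagonal:
  assumes "finite I" "I' \<subseteq> I" "J' \<subseteq> I"
    and "\<And>s t. s \<in> I \<Longrightarrow> t \<in> I \<Longrightarrow> s \<noteq> t \<Longrightarrow> form n A (v s) (v t) = 0"
  shows "form n A (\<lambda>i. \<Sum>s\<in>I'. c s * v s i) (\<lambda>i. \<Sum>s\<in>J'. c s * v s i)
    = (\<Sum>s\<in>I' \<inter> J'. cnj (c s) * c s * form n A (v s) (v s))"
proof -
  have "form n A (\<lambda>i. \<Sum>s\<in>I'. c s * v s i) (\<lambda>i. \<Sum>s\<in>J'. c s * v s i)
      = (\<Sum>t\<in>J'. \<Sum>s\<in>I'. if s = t then cnj (c s) * c s * form n A (v s) (v s) else 0)"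
    unfolding form_sum_right form_sum_left sum_distrib_left
  proof (intro sum.cong refl)
    fix t s assume "t \<in> J'" "s \<in> I'"
    then show "c t * (cnj (c s) * form n A (v s) (v t))
        = (if s = t then cnj (c s) * c s * form n A (v s) (v s) else 0)"
      using assms(2-4) by auto
  qed
  also have "\<dots> = (\<Sum>t\<in>J'. if t \<in> I' then cnj (c t) * c t * form n A (v t) (v t) else 0)"
    by (intro sum.cong refl) (simp add: finite_subset[OF assms(2,1)])
  also have "\<dots> = (\<Sum>s\<in>J' \<inter> I'. cnj (c s) * c s * form n A (v s) (v s))"
    by (rule sum.inter_restrict[symmetric]) (rule finite_subset[OF assms(3,1)])
  finally show ?thesis by (simp add: Int_commute)
qed

text \<open>The vectors \<open>v s\<close> are orthogonal with respect to every form in \<open>E\<close>, so a Tverberg partition of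
  the points \<open>(\<langle>v s, b k v s\<rangle>)\<^sub>k\<close> with coefficients \<open>\<alpha> s\<close> turns into the orthonormal
  basis \<open>\<Sum>s. sqrt (\<alpha> s) v s\<close> of a code, one basis vector for each part.\<close>
lemma code_exists:
  assumes E: "quantum_graph n m E" and X: "finite X" and r: "r \<ge> 1"
    and bound: "card X + (r - 1) * (m + 1)\<^sup>2 < n"
  shows "\<exists>u. orthonormal n {..<r} u \<and> (\<forall>x\<in>X. \<forall>c<r. ip n (w x) (u c) = 0) \<and>
    is_code n E (proj_of n {..<r} u)"
proof -
  define d where "d = m + 1"
  obtain bs c0 where bs: "length bs = d" "E = {real_lincomb n c bs | c. True}"
    "\<And>k. k < d \<Longrightarrow> self_adjoint n (bs ! k)" and one: "1\<^sub>m n = real_lincomb n c0 bs"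
    using quantum_graphE[OF E] unfolding d_def by blast
  \<comment> \<open>The Tverberg number for \<open>r\<close> parts in affine dimension
    \<open>m = d - 1\<close>. Finding \<open>N\<close> vectors costs
    \<open>(N - 1) * d = (r - 1) * d^2\<close> conditions, whence the square in the upper
    bound.\<close>
  define N where "N = (r - 1) * d + 1"
  have "card X + (N - 1) * d < n"
    using bound by (simp add: N_def d_def power2_eq_square algebra_simps)
  then obtain v where v1: "\<And>s. s < N \<Longrightarrow> ip n (v s) (v s) = 1"
    and vX: "\<And>s x. s < N \<Longrightarrow> x \<in> X \<Longrightarrow> ip n (w x) (v s) = 0"
    and vlt: "\<And>s s' k. s < N \<Longrightarrow> s' < s \<Longrightarrow> k < d \<Longrightarrow> form n (bs ! k) (v s') (v s) = 0"
    using greedy_orthogonal_vectors[OF X, where N = N and d = d and n = n and w = w and bs = "\<lambda>k. bs ! k"] by blast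
  have vne: "form n (bs ! k) (v s) (v t) = 0" if "s \<noteq> t" "s < N" "t < N" "k < d" for s t k
  proof (cases "s < t")
    case False
    then have "form n (bs ! k) (v t) (v s) = 0" using vlt that by simp
    then show ?thesis using form_self_adjoint[OF bs(3)[OF that(4)], of "v t" "v s"] by simp
  qed (use vlt that in simp)
  define y where "y s k = Re (form n (bs ! k) (v s) (v s))" for s k
  have vy: "form n (bs ! k) (v s) (v s) = complex_of_real (y s k)" if "k < d" for s k
    using form_self_adjoint[OF bs(3)[OF that], of "v s" "v s"]
    by (simp add: y_def complex_eq_iff)
  \<comment> \<open>The identity lies in \<open>E\<close>, so the points \<open>y s\<close> lie on
    an affine hyperplane, whose equation has the coefficients \<open>c0\<close>; Tverberg's theorem
    is thus applied in dimension \<open>m\<close>.\<close>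
  have y1: "(\<Sum>k<d. c0 k * y s k) = 1" if "s < N" for s
  proof -
    have "complex_of_real (\<Sum>k<d. c0 k * y s k) = form n (1\<^sub>m n) (v s) (v s)"
      unfolding one form_real_lincomb bs(1) of_real_sum by (intro sum.cong refl) (simp add: vy)
    then have "complex_of_real (\<Sum>k<d. c0 k * y s k) = complex_of_real 1"
      using v1[OF that] by (simp add: form_one)
    then show ?thesis unfolding of_real_eq_iff .
  qed
  have "(r - 1) * d < N" by (simp add: N_def)
  then have "\<exists>f \<alpha> x. (\<forall>i<N. f i < r) \<and> (\<forall>i<N. \<alpha> i \<ge> 0) \<and>
    (\<forall>c<r. (\<Sum>i | i < N \<and> f i = c. \<alpha> i) = 1) \<and>
    (\<forall>c<r. \<forall>k<d. (\<Sum>i | i < N \<and> f i = c. \<alpha> i * y i k) = x k)"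
    by (rule tverberg_in_hyperplane[OF r, where l = c0]) (rule y1)
  then obtain f \<alpha> x where "(\<forall>i<N. f i < r) \<and> (\<forall>i<N. \<alpha> i \<ge> 0) \<and>
    (\<forall>c<r. (\<Sum>i | i < N \<and> f i = c. \<alpha> i) = 1) \<and>
    (\<forall>c<r. \<forall>k<d. (\<Sum>i | i < N \<and> f i = c. \<alpha> i * y i k) = x k)"
    by (elim exE)
  then have f: "\<And>i. i < N \<Longrightarrow> f i < r" and \<alpha>: "\<And>i. i < N \<Longrightarrow> \<alpha> i \<ge> 0"
    and \<alpha>1: "\<And>c. c < r \<Longrightarrow> (\<Sum>i | i < N \<and> f i = c. \<alpha> i) = 1"
    and x: "\<And>c k. c < r \<Longrightarrow> k < d \<Longrightarrow> (\<Sum>i | i < N \<and> f i = c. \<alpha> i * y i k) = x k"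
    by auto
  define P where "P c = {i. i < N \<and> f i = c}" for c
  define g where "g i = complex_of_real (sqrt (\<alpha> i))" for i
  define u where "u c = (\<lambda>j. \<Sum>i\<in>P c. g i * v i j)" for c
  have gg: "cnj (g i) * g i = complex_of_real (\<alpha> i)" if "i < N" for i
    using \<alpha>[OF that] by (simp add: g_def flip: of_real_mult)
  have u_form: "form n (bs ! k) (u c) (u c') = (if c = c' then complex_of_real (x k) else 0)"
    if "k < d" "c < r" "c' < r" for k c c'
  proof -
    have "form n (bs ! k) (u c) (u c') = (\<Sum>i\<in>P c \<inter> P c'. cnj (g i) * g i * form n (bs ! k) (v i) (v i))"
      unfolding u_def using vne that(1)
      by (intro form_comb_diagonal[of "{..<N}"]) (auto simp: P_def)
    also have "\<dots> = complex_of_real (\<Sum>i\<in>P c \<inter> P c'. \<alpha> i * y i k)"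
      unfolding of_real_sum by (intro sum.cong refl) (auto simp: P_def gg vy[OF that(1)])
    also have "\<dots> = (if c = c' then complex_of_real (x k) else 0)"
    proof (cases "c = c'")
      case True
      then show ?thesis using x[OF that(2,1)] by (simp add: P_def)
    next
      case False
      then have "P c \<inter> P c' = {}" by (auto simp: P_def)
      then show ?thesis using False by simp
    qed
    finally show ?thesis .
  qed
  define \<epsilon> where "\<epsilon> A = (let h = (SOME h. A = real_lincomb n h bs) in \<Sum>k<d. h k * x k)" for A
  have u_E: "form n A (u c) (u c') = (if c = c' then complex_of_real (\<epsilon> A) else 0)"
    if "A \<in> E" "c < r" "c' < r" for A c c'
  proof -
    define h where "h = (SOME h. A = real_lincomb n h bs)"
    have h: "A = real_lincomb n h bs" using that(1) someI_ex[of "\<lambda>h. A = real_lincomb n h bs"]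
      unfolding h_def bs(2) by blast
    have "form n A (u c) (u c') = (\<Sum>k<d. complex_of_real (h k) * form n (bs ! k) (u c) (u c'))"
      unfolding h form_real_lincomb bs(1) ..
    also have "\<dots> = (\<Sum>k<d. if c = c' then complex_of_real (h k * x k) else 0)"
      using u_form that by (intro sum.cong refl) auto
    finally show ?thesis by (simp add: \<epsilon>_def h_def)
  qed
  have u_ip: "ip n (u c) (u c') = (if c = c' then 1 else 0)" if "c < r" "c' < r" for c c'
  proof (cases "c = c'")
    case True
    \<comment> \<open>Since the identity is a combination of \<open>bs\<close>, the vectors are also
      orthogonal in the ordinary sense.\<close>
    have ne: "ip n (v s) (v t) = 0" if "s < N" "t < N" "s \<noteq> t" for s t
      unfolding form_one[symmetric] one form_real_lincomb bs(1)
      using vne that by (intro sum.neutral) auto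
    have "ip n (u c) (u c) = (\<Sum>i\<in>P c \<inter> P c. cnj (g i) * g i * form n (1\<^sub>m n) (v i) (v i))"
      unfolding u_def form_one[symmetric]
      by (intro form_comb_diagonal[of "{..<N}"]) (auto simp: P_def form_one ne)
    also have "\<dots> = complex_of_real (\<Sum>i\<in>P c. \<alpha> i)"
      unfolding of_real_sum Int_absorb by (intro sum.cong refl) (auto simp: P_def gg form_one v1)
    also have "(\<Sum>i\<in>P c. \<alpha> i) = 1" using \<alpha>1[OF that(1)] by (simp add: P_def)
    finally show ?thesis using True by simp
  next
    case False
    have "1\<^sub>m n \<in> E" using E by (simp add: quantum_graph_def)
    from u_E[OF this that] show ?thesis using False by (simp add: form_one)
  qed
  have "is_code n E (proj_of n {..<r} u)"
  proof (rule is_code_proj_of)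
    show "A \<in> carrier_mat n n" if "A \<in> E" for A
      using E that by (auto simp: quantum_graph_def self_adjoint_def)
    show "orthonormal n {..<r} u" using u_ip by (simp add: orthonormal_def)
    show "form n A (u c) (u c') = (if c = c' then complex_of_real (\<epsilon> A) else 0)"
      if "A \<in> E" "c \<in> {..<r}" "c' \<in> {..<r}" for A c c' using u_E that by simp
  qed simp
  moreover have "ip n (w x) (u c) = 0" if "x \<in> X" for x c
    unfolding u_def ip_sum_right using vX that by (intro sum.neutral) (auto simp: P_def)
  moreover have "orthonormal n {..<r} u" using u_ip by (simp add: orthonormal_def)
  ultimately show ?thesis by blast
qed

section \<open>The step logarithm and the greedy recursion\<close>

declare slog.simps [simp del]

lemma slog_0 [simp]: "slog 0 q = 0"
  by (subst slog.simps) simp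

lemma slog_step:
  "p \<ge> 1 \<Longrightarrow> q \<ge> 1 \<Longrightarrow> slog p q = slog (p - nat \<lceil>real p / real q\<rceil>) q + 1"
  by (subst slog.simps) simp

text \<open>\<open>(r - 1) * q < p\<close> leaves room for a code of dimension \<open>r\<close> in a
  complement of dimension \<open>p\<close>; \<open>p \<le> r * q\<close> serves the lower
  bound.\<close>

lemma ceiling_quotient_bounds:
  assumes "p \<ge> 1" "q \<ge> 1"
  defines "r \<equiv> nat \<lceil>real p / real q\<rceil>"
  shows "r \<ge> 1" "r \<le> p" "(r - 1) * q < p" "p \<le> r * q"
proof -
  have pos: "real p / real q > 0" using assms(1,2) by simp
  then show r1: "r \<ge> 1" unfolding r_def by linarith
  have "real p / real q \<le> real p / 1" using assms(2) by (intro divide_left_mono) auto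
  then show "r \<le> p" unfolding r_def by (simp add: nat_le_iff ceiling_le_iff)
  have "real r < real p / real q + 1" using pos unfolding r_def by linarith
  then have "real (r - 1) < real p / real q" using r1 by simp
  then have "real (r - 1) * real q < real p" using assms(2) by (simp add: field_simps)
  then show "(r - 1) * q < p" by (metis of_nat_less_iff of_nat_mult)
  have "real p / real q \<le> real r" using pos unfolding r_def by linarith
  then have "real p \<le> real r * real q" using assms(2) by (simp add: field_simps)
  then show "p \<le> r * q" by (metis of_nat_le_iff of_nat_mult)
qed

text \<open>The family \<open>w\<close> spans the codes chosen so far, and \<open>K\<close> is to
  colour its complement of dimension \<open>p\<close>. Each round adds a code of dimension
  \<open>r\<close>, which is the recursion of \<open>slog\<close>. That the members of
  \<open>K\<close> annihilate \<open>w\<close> is carried along to tell them from the codes chosen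
  earlier: a colouring is a set, so equal projections would be counted once.\<close>

lemma greedy_coloring:
  assumes E: "quantum_graph n m E" and "t + p = n" "orthonormal n {..<t} w"
  shows "\<exists>K. finite K \<and> card K = slog p ((m + 1)\<^sup>2) \<and> (\<forall>P\<in>K. is_code n E P) \<and>
    (\<forall>P\<in>K. \<forall>x<t. \<forall>i<n. (\<Sum>j<n. P $$ (i, j) * w x j) = 0) \<and>
    (\<forall>i<n. \<forall>j<n. (\<Sum>P\<in>K. P $$ (i, j)) = 1\<^sub>m n $$ (i, j) - (\<Sum>x<t. w x i * cnj (w x j)))"
  using assms(2,3)
proof (induction p arbitrary: t w rule: less_induct)
  case (less p)
  show ?case
  proof (cases "p = 0")
    case True
    then have "(\<Sum>x<t. w x i * cnj (w x j)) = 1\<^sub>m n $$ (i, j)" if "i < n" "j < n" for i j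
      using orthonormal_complete[of "{..<t}" n w i j] less.prems that by simp
    then show ?thesis using True by (intro exI[of _ "{}"]) auto
  next
    case False
    define q where "q = (m + 1)\<^sup>2"
    define r where "r = nat \<lceil>real p / real q\<rceil>"
    have r: "r \<ge> 1" "r \<le> p" "(r - 1) * q < p"
      unfolding r_def by (rule ceiling_quotient_bounds; use False in \<open>simp add: q_def\<close>)+
    have "card {..<t} + (r - 1) * (m + 1)\<^sup>2 < n"
      using r less.prems(1) by (simp add: q_def)
    from code_exists[OF E _ r(1) this, of w]
    obtain u where u: "orthonormal n {..<r} u" "\<And>x c. x < t \<Longrightarrow> c < r \<Longrightarrow> ip n (w x) (u c) = 0"
      "is_code n E (proj_of n {..<r} u)" by auto
    define P where "P = proj_of n {..<r} u"
    define w' where "w' x = (if x < t then w x else u (x - t))" for x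
    have uw: "ip n (u c) (w x) = 0" if "x < t" "c < r" for x c
      using u(2)[OF that] ip_cnj[of n "w x" "u c"] by simp
    have "orthonormal n {..<t + r} w'"
      unfolding orthonormal_def using orthonormalD[OF less.prems(2)] orthonormalD[OF u(1)] u(2) uw
      by (auto simp: w'_def)
    moreover have "p - r < p" "t + r + (p - r) = n" using r less.prems(1) by auto
    ultimately have "\<exists>K. finite K \<and> card K = slog (p - r) q \<and> (\<forall>P\<in>K. is_code n E P) \<and>
      (\<forall>P\<in>K. \<forall>x<t + r. \<forall>i<n. (\<Sum>j<n. P $$ (i, j) * w' x j) = 0) \<and>
      (\<forall>i<n. \<forall>j<n. (\<Sum>P\<in>K. P $$ (i, j))
        = 1\<^sub>m n $$ (i, j) - (\<Sum>x<t + r. w' x i * cnj (w' x j)))"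
      unfolding q_def by (intro less.IH)
    then obtain K where K: "finite K" "card K = slog (p - r) q" "\<forall>P\<in>K. is_code n E P"
      "\<forall>P\<in>K. \<forall>x<t + r. \<forall>i<n. (\<Sum>j<n. P $$ (i, j) * w' x j) = 0"
      "\<forall>i<n. \<forall>j<n. (\<Sum>P\<in>K. P $$ (i, j))
        = 1\<^sub>m n $$ (i, j) - (\<Sum>x<t + r. w' x i * cnj (w' x j))"
      by (elim exE conjE)
    have K4: "(\<Sum>j<n. P $$ (i, j) * w' x j) = 0" if "P \<in> K" "x < t + r" "i < n" for P x i
      using K(4) that by blast
    have P_apply: "(\<Sum>j<n. P $$ (i, j) * v j) = (\<Sum>c<r. u c i * ip n (u c) v)" if "i < n" for i v
      unfolding P_def by (rule proj_of_apply) fact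
    \<comment> \<open>\<open>P\<close> fixes the unit vector \<open>u 0\<close>, while all members
      of \<open>K\<close> annihilate it.\<close>
    have "P \<notin> K"
    proof
      assume "P \<in> K"
      have "u 0 i = 0" if "i < n" for i
      proof -
        have "(\<Sum>c<r. u c i * ip n (u c) (u 0)) = (\<Sum>c<r. if c = 0 then u c i else 0)"
          using r(1) by (intro sum.cong refl) (simp add: orthonormalD[OF u(1)])
        then show ?thesis
          using K4[OF \<open>P \<in> K\<close>, of t i] r(1) that by (simp add: w'_def P_apply)
      qed
      then have "ip n (u 0) (u 0) = 0" by (simp add: ip_def)
      then show False using orthonormalD[OF u(1), of 0 0] r(1) by simp
    qed
    have split: "(\<Sum>x<t + r. w' x i * cnj (w' x j)) = (\<Sum>x<t. w x i * cnj (w x j)) + (\<Sum>c<r. u c i * cnj (u c j))"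
      for i j
    proof -
      have "(\<Sum>x<t + r. w' x i * cnj (w' x j)) = (\<Sum>x<t. w' x i * cnj (w' x j))
          + (\<Sum>c<r. w' (t + c) i * cnj (w' (t + c) j))"
        by (induction r) (simp_all add: add.assoc)
      then show ?thesis by (simp add: w'_def)
    qed
    show ?thesis
    proof (intro exI[of _ "insert P K"] conjI ballI allI impI)
      show "card (insert P K) = slog p ((m + 1)\<^sup>2)"
        using K(1,2) \<open>P \<notin> K\<close> slog_step[of p q] False by (simp add: q_def r_def)
      show "is_code n E P'" if "P' \<in> insert P K" for P' using that K(3) u(3) by (auto simp: P_def)
      show "(\<Sum>j<n. P' $$ (i, j) * w x j) = 0" if "P' \<in> insert P K" "x < t" "i < n" for P' x i
        using that K4[of P' x i] by (auto simp: P_apply uw w'_def)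
      show "(\<Sum>P\<in>insert P K. P $$ (i, j)) = 1\<^sub>m n $$ (i, j) - (\<Sum>x<t. w x i * cnj (w x j))"
        if "i < n" "j < n" for i j
        using K(1) \<open>P \<notin> K\<close> K(5) that by (simp add: P_def split)
    qed (use K(1) in simp)
  qed
qed

lemma coloring_exists:
  assumes "quantum_graph n m E"
  shows "\<exists>K. is_coloring n E K \<and> card K = slog n ((m + 1)\<^sup>2)"
  using greedy_coloring[OF assms, of 0 n "\<lambda>_ _. 0"] by (auto simp: is_coloring_def orthonormal_def)

lemma chromatic_number_le:
  assumes "quantum_graph n m E"
  shows "chromatic_number n E \<le> slog n ((m + 1)\<^sup>2)"
  unfolding chromatic_number_def using coloring_exists[OF assms] by (intro Least_le) blast

section \<open>Orthonormal bases adapted to a colouring\<close>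

lemma ip_proj_of:
  "(\<Sum>i<n. cnj (u i) * (\<Sum>x\<in>X. w x i * z x)) = (\<Sum>x\<in>X. ip n u (w x) * z x)"
  unfolding ip_def sum_distrib_left sum_distrib_right
  by (subst sum.swap) (intro sum.cong refl, simp add: algebra_simps)

lemma form_proj_of: "form n (proj_of n X w) u v = (\<Sum>x\<in>X. ip n u (w x) * ip n (w x) v)"
proof -
  have "form n (proj_of n X w) u v = (\<Sum>i<n. cnj (u i) * (\<Sum>x\<in>X. w x i * ip n (w x) v))"
    unfolding form_def mult.assoc sum_distrib_left[symmetric]
    by (intro sum.cong refl arg_cong2[of _ _ _ _ times] proj_of_apply) simp
  then show ?thesis unfolding ip_proj_of .
qed

lemma form_cong:
  "(\<And>i j. i < n \<Longrightarrow> j < n \<Longrightarrow> A $$ (i, j) = B $$ (i, j)) \<Longrightarrow> form n A u v = form n B u v"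
  unfolding form_def by (intro sum.cong refl) simp

lemma form_smult: "A \<in> carrier_mat n n \<Longrightarrow> form n (c \<cdot>\<^sub>m A) u v = c * form n A u v"
  unfolding form_def sum_distrib_left by (intro sum.cong refl) (simp add: algebra_simps)

lemma form_proj_sandwich:
  assumes A: "A \<in> carrier_mat n n"
  shows "form n (proj_of n X w * A * proj_of n X w) u v
    = (\<Sum>x\<in>X. \<Sum>y\<in>X. ip n u (w x) * form n A (w x) (w y) * ip n (w y) v)"
proof -
  have "form n (proj_of n X w * A * proj_of n X w) u v
    = (\<Sum>i<n. \<Sum>j<n. cnj (u i) * (\<Sum>x\<in>X. w x i * (\<Sum>y\<in>X. form n A (w x) (w y) * cnj (w y j))) * v j)"
    unfolding form_def[of n "proj_of n X w * A * proj_of n X w"]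
    by (intro sum.cong refl) (simp add: proj_sandwich_index[OF A] sum_distrib_left mult.assoc del: index_mult_mat)
  also have "\<dots> = (\<Sum>j<n. \<Sum>i<n. cnj (u i) * (\<Sum>x\<in>X. w x i * (\<Sum>y\<in>X. form n A (w x) (w y) * cnj (w y j))) * v j)"
    by (rule sum.swap)
  also have "\<dots> = (\<Sum>j<n. \<Sum>x\<in>X. ip n u (w x) * (\<Sum>y\<in>X. form n A (w x) (w y) * (cnj (w y j) * v j)))"
    unfolding sum_distrib_right[symmetric] ip_proj_of
    by (simp add: sum_distrib_right mult.assoc)
  also have "\<dots> = (\<Sum>x\<in>X. \<Sum>j<n. ip n u (w x) * (\<Sum>y\<in>X. form n A (w x) (w y) * (cnj (w y j) * v j)))"
    by (rule sum.swap)
  also have "\<dots> = (\<Sum>x\<in>X. ip n u (w x) * (\<Sum>j<n. \<Sum>y\<in>X. form n A (w x) (w y) * (cnj (w y j) * v j)))"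
    by (simp add: sum_distrib_left)
  also have "\<dots> = (\<Sum>x\<in>X. ip n u (w x) * (\<Sum>y\<in>X. \<Sum>j<n. form n A (w x) (w y) * (cnj (w y j) * v j)))"
    by (intro sum.cong refl arg_cong2[of _ _ _ _ times], rule sum.swap)
  finally show ?thesis by (simp add: ip_def[of n "w _" v] sum_distrib_left mult.assoc)
qed

text \<open>Take a largest orthonormal family of vectors fixed by \<open>P\<close>. Were
  \<open>P\<close> not its projection, a nonzero column of the difference would be fixed by
  \<open>P\<close>, because \<open>P * P = P\<close>, and orthogonal to the family, because
  \<open>P\<close> is self-adjoint; so the family could be enlarged.\<close>

lemma orth_proj_basis:
  assumes P: "orth_proj n P"
  shows "\<exists>d u. orthonormal n {..<d::nat} u \<and> P = proj_of n {..<d} u"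
proof -
  have Pc: "P \<in> carrier_mat n n" and PP: "P * P = P" and Pa: "mat_adjoint P = P"
    using P by (auto simp: orth_proj_def)
  define fixed where "fixed v \<longleftrightarrow> (\<forall>i<n. (\<Sum>j<n. P $$ (i, j) * v j) = v i)" for v
  define S where "S = {d. \<exists>u. orthonormal n {..<d::nat} u \<and> (\<forall>c<d. fixed (u c))}"
  have "S \<subseteq> {..n}" using orthonormal_card_le[of "{..<_::nat}"] by (fastforce simp: S_def)
  then have "finite S" by (rule finite_subset) simp
  moreover have "0 \<in> S" by (simp add: S_def orthonormal_def)
  ultimately have "Max S \<in> S" by (intro Max_in) auto
  define d where "d = Max S"
  obtain u where u: "orthonormal n {..<d} u" "\<And>c. c < d \<Longrightarrow> fixed (u c)"
    using \<open>Max S \<in> S\<close> by (auto simp: S_def d_def)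
  have "P $$ (i, j) = (\<Sum>c<d. u c i * cnj (u c j))" if ij: "i < n" "j < n" for i j
  proof (rule ccontr)
    assume ne: "P $$ (i, j) \<noteq> (\<Sum>c<d. u c i * cnj (u c j))"
    define r where "r k = P $$ (k, j) - (\<Sum>c<d. cnj (u c j) * u c k)" for k
    have "r i \<noteq> 0" using ne by (simp add: r_def mult.commute)
    then obtain t where t: "ip n (\<lambda>i. t * r i) (\<lambda>i. t * r i) = 1"
      using normalize_vector ij(1) by blast
    have "(\<Sum>l<n. P $$ (k, l) * r l) = r k" if k: "k < n" for k
    proof -
      have "(\<Sum>l<n. P $$ (k, l) * r l) = (P * P) $$ (k, j)
          - (\<Sum>l<n. \<Sum>c<d. cnj (u c j) * (P $$ (k, l) * u c l))"
        unfolding mat_mult_index[OF Pc Pc k ij(2)] r_def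
        by (simp add: right_diff_distrib sum_subtractf sum_distrib_left algebra_simps)
      also have "\<dots> = P $$ (k, j) - (\<Sum>c<d. cnj (u c j) * (\<Sum>l<n. P $$ (k, l) * u c l))"
        unfolding PP by (subst sum.swap) (simp add: sum_distrib_left)
      also have "\<dots> = r k" unfolding r_def using u(2) k by (simp add: fixed_def)
      finally show ?thesis .
    qed
    then have fr: "fixed (\<lambda>i. t * r i)"
      unfolding fixed_def by (simp add: mult.left_commute[of _ t] sum_distrib_left[symmetric])
    have orth: "ip n (u c) r = 0" if c: "c < d" for c
    proof -
      have "ip n (u c) r = (\<Sum>k<n. cnj (u c k) * P $$ (k, j)) - ip n (u c) (\<lambda>k. \<Sum>c<d. cnj (u c j) * u c k)"
        unfolding ip_def r_def by (simp add: right_diff_distrib sum_subtractf)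
      also have "(\<Sum>k<n. cnj (u c k) * P $$ (k, j)) = cnj (\<Sum>k<n. P $$ (j, k) * u c k)"
        unfolding cnj_sum using mat_adjoint_index[OF Pc _ ij(2)] ij
        by (intro sum.cong refl) (auto simp: Pa mult.commute)
      also have "(\<Sum>k<n. P $$ (j, k) * u c k) = u c j"
        using u(2)[OF c] ij(2) by (simp add: fixed_def)
      also have "ip n (u c) (\<lambda>k. \<Sum>c<d. cnj (u c j) * u c k) = (\<Sum>b<d. if b = c then cnj (u c j) else 0)"
        unfolding ip_sum_right using orthonormalD[OF u(1)] c by (intro sum.cong refl) auto
      finally show ?thesis using c by simp
    qed
    have "orthonormal n {..<Suc d} (u(d := \<lambda>i. t * r i))"
      unfolding orthonormal_def
    proof (intro ballI)
      fix b c assume "b \<in> {..<Suc d}" "c \<in> {..<Suc d}"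
      then show "ip n ((u(d := \<lambda>i. t * r i)) b) ((u(d := \<lambda>i. t * r i)) c) = (if b = c then 1 else 0)"
        using t orth orthonormalD[OF u(1)] ip_cnj[of n "u c" r] ip_cnj[of n "u b" r]
        by (auto simp: less_Suc_eq ip_scale)
    qed
    then have "Suc d \<in> S" unfolding S_def using fr u(2)
      by (auto intro!: exI[of _ "u(d := \<lambda>i. t * r i)"] simp: less_Suc_eq)
    then have "Suc d \<le> d" unfolding d_def using \<open>finite S\<close> by (rule Max_ge[rotated])
    then show False by simp
  qed
  then have "P = proj_of n {..<d} u" using Pc by (intro eq_matI) auto
  then show ?thesis using u(1) by blast
qed

text \<open>By Parseval \<open>1 = \<parallel>w x\<parallel>\<^sup>2 = \<Sum>y. |\<langle>w y, w x\<rangle>|\<^sup>2\<close>, where the term \<open>y = x\<close> is already \<open>1\<close>.\<close>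
lemma unit_frame_orthonormal:
  assumes X: "finite X" and unit: "\<And>x. x \<in> X \<Longrightarrow> ip n (w x) (w x) = 1"
    and frame: "\<And>i j. i < n \<Longrightarrow> j < n \<Longrightarrow> (\<Sum>x\<in>X. w x i * cnj (w x j)) = (if i = j then 1 else 0)"
  shows "orthonormal n X w" "card X = n"
proof -
  have pars: "ip n v v = (\<Sum>x\<in>X. ip n v (w x) * ip n (w x) v)" for v
  proof -
    have "ip n v v = form n (1\<^sub>m n) v v" by (simp add: form_one)
    also have "\<dots> = form n (proj_of n X w) v v" by (rule form_cong) (simp add: frame)
    finally show ?thesis unfolding form_proj_of .
  qed
  show "orthonormal n X w" unfolding orthonormal_def
  proof (intro ballI)
    fix y x assume y: "y \<in> X" and x: "x \<in> X"
    show "ip n (w y) (w x) = (if y = x then 1 else 0)"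
    proof (cases "y = x")
      case False
      define f where "f z = (cmod (ip n (w z) (w x)))\<^sup>2" for z
      have "complex_of_real (\<Sum>z\<in>X. f z) = (\<Sum>z\<in>X. ip n (w x) (w z) * ip n (w z) (w x))"
        unfolding of_real_sum f_def complex_norm_square ip_cnj
        by (intro sum.cong refl) (simp add: mult.commute)
      also have "\<dots> = complex_of_real 1" using pars[of "w x"] unit[OF x] by simp
      finally have "(\<Sum>z\<in>X. f z) = 1" unfolding of_real_eq_iff .
      then have "(\<Sum>z\<in>X - {x}. f z) = 0"
        using sum.remove[OF X x, of f] unit[OF x] by (simp add: f_def)
      then have "\<forall>z\<in>X - {x}. f z = 0"
        using X by (subst (asm) sum_nonneg_eq_0_iff) (auto simp: f_def)
      then show ?thesis using False y by (simp add: f_def)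
    qed (simp add: unit x)
  qed
  have "complex_of_nat (card X) = (\<Sum>x\<in>X. ip n (w x) (w x))" using unit by simp
  also have "\<dots> = (\<Sum>i<n. \<Sum>x\<in>X. w x i * cnj (w x i))"
    unfolding ip_def by (subst sum.swap) (simp add: mult.commute)
  also have "\<dots> = complex_of_nat n" by (simp add: frame)
  finally show "card X = n" by (simp only: of_nat_eq_iff)
qed

text \<open>As the projections sum to the identity, the bases of all the codes together form a frame
  of unit vectors, which is orthonormal by \<open>unit_frame_orthonormal\<close>. Hence the codes
  are mutually orthogonal and their dimensions add up to \<open>n\<close>.\<close>

lemma coloring_basis:
  assumes "is_coloring n E K" and E: "\<And>A. A \<in> E \<Longrightarrow> A \<in> carrier_mat n n"
  shows "\<exists>d u. orthonormal n (SIGMA P:K. {..<d P}) (\<lambda>(P, c). u P c) \<and> (\<Sum>P\<in>K. d P) = n \<and>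
    (\<forall>A\<in>E. \<forall>P\<in>K. \<exists>\<epsilon>::real. \<forall>b<d P. \<forall>c<d P.
      form n A (u P b) (u P c) = (if b = c then complex_of_real \<epsilon> else 0))"
proof -
  have fin: "finite K" and code: "\<And>P. P \<in> K \<Longrightarrow> is_code n E P"
    and sum1: "\<And>i j. i < n \<Longrightarrow> j < n \<Longrightarrow> (\<Sum>P\<in>K. P $$ (i, j)) = 1\<^sub>m n $$ (i, j)"
    using assms(1) by (auto simp: is_coloring_def)
  have "\<forall>P\<in>K. \<exists>du::nat \<times> (nat \<Rightarrow> nat \<Rightarrow> complex). orthonormal n {..<fst du} (snd du) \<and> P = proj_of n {..<fst du} (snd du)"
  proof
    fix P assume "P \<in> K"
    then have "orth_proj n P" using code by (simp add: is_code_def)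
    from orth_proj_basis[OF this] obtain d u
      where "orthonormal n {..<d::nat} u \<and> P = proj_of n {..<d} u" by (elim exE)
    then show "\<exists>du::nat \<times> (nat \<Rightarrow> nat \<Rightarrow> complex). orthonormal n {..<fst du} (snd du) \<and> P = proj_of n {..<fst du} (snd du)"
      by (intro exI[of _ "(d, u)"]) (simp only: fst_conv snd_conv)
  qed
  from bchoice[OF this] obtain du :: "complex mat \<Rightarrow> nat \<times> (nat \<Rightarrow> nat \<Rightarrow> complex)" where
    du: "\<forall>P\<in>K. orthonormal n {..<fst (du P)} (snd (du P)) \<and> P = proj_of n {..<fst (du P)} (snd (du P))"
    by (rule exE)
  define d where "d P = fst (du P)" for P
  define u where "u P = snd (du P)" for P
  have on: "orthonormal n {..<d P} (u P)" if "P \<in> K" for P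
    using du that by (simp add: d_def u_def)
  have Pu: "P = proj_of n {..<d P} (u P)" if "P \<in> K" for P
    using du that unfolding d_def u_def by blast
  define X where "X = (SIGMA P:K. {..<d P})"
  have X: "finite X" using fin by (simp add: X_def)
  have "(\<Sum>x\<in>X. (case x of (P, c) \<Rightarrow> u P c) i * cnj ((case x of (P, c) \<Rightarrow> u P c) j)) = (if i = j then 1 else 0)"
    if ij: "i < n" "j < n" for i j
  proof -
    have "(\<Sum>x\<in>X. (case x of (P, c) \<Rightarrow> u P c) i * cnj ((case x of (P, c) \<Rightarrow> u P c) j))
        = (\<Sum>P\<in>K. \<Sum>c<d P. u P c i * cnj (u P c j))"
      unfolding X_def using fin by (subst sum.Sigma) (auto intro!: sum.cong)
    also have "\<dots> = (\<Sum>P\<in>K. P $$ (i, j))"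
    proof (rule sum.cong[OF refl])
      fix P assume "P \<in> K"
      have "P $$ (i, j) = proj_of n {..<d P} (u P) $$ (i, j)"
        using Pu[OF \<open>P \<in> K\<close>] by (rule arg_cong)
      then show "(\<Sum>c<d P. u P c i * cnj (u P c j)) = P $$ (i, j)" using ij by simp
    qed
    finally show ?thesis using sum1[OF ij] ij by simp
  qed
  moreover have "ip n (case x of (P, c) \<Rightarrow> u P c) (case x of (P, c) \<Rightarrow> u P c) = 1" if "x \<in> X" for x
    using that on by (auto simp: X_def orthonormal_def)
  ultimately have *: "orthonormal n X (\<lambda>(P, c). u P c)" "card X = n"
    using unit_frame_orthonormal[OF X, of n "\<lambda>(P, c). u P c"] by blast+
  have "(\<Sum>P\<in>K. d P) = n" using *(2) fin by (simp add: X_def)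
  moreover have "\<exists>\<epsilon>::real. \<forall>b<d P. \<forall>c<d P. form n A (u P b) (u P c) = (if b = c then complex_of_real \<epsilon> else 0)"
    if A: "A \<in> E" and P: "P \<in> K" for A P
  proof -
    obtain \<epsilon> where eps: "P * A * P = complex_of_real \<epsilon> \<cdot>\<^sub>m P"
      using code[OF P] A unfolding is_code_def by blast
    \<comment> \<open>\<open>P\<close> is also an argument of \<open>d\<close> and \<open>u\<close>,
      so replacing \<open>P\<close> by its expansion would hit these occurrences too;
      \<open>Q\<close> names the expansion.\<close>
    define Q where "Q = proj_of n {..<d P} (u P)"
    have Q: "Q * A * Q = complex_of_real \<epsilon> \<cdot>\<^sub>m Q" unfolding Q_def using eps Pu[OF P] by metis
    have "form n A (u P b) (u P c) = (if b = c then complex_of_real \<epsilon> else 0)" if "b < d P" "c < d P" for b c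
    proof -
      note o = orthonormalD[OF on[OF P]]
      have "form n (Q * A * Q) (u P b) (u P c)
          = (\<Sum>x<d P. \<Sum>y<d P. if x = b then if y = c then form n A (u P b) (u P c) else 0 else 0)"
        unfolding Q_def form_proj_sandwich[OF E[OF A]] using that
        by (intro sum.cong refl) (auto simp: o)
      also have "\<dots> = (\<Sum>x<d P. if x = b then (\<Sum>y<d P. if y = c then form n A (u P b) (u P c) else 0) else 0)"
        by (intro sum.cong refl) auto
      also have "\<dots> = form n A (u P b) (u P c)" using that by simp
      finally have 1: "form n (Q * A * Q) (u P b) (u P c) = form n A (u P b) (u P c)" .
      have "form n (complex_of_real \<epsilon> \<cdot>\<^sub>m Q) (u P b) (u P c)
          = complex_of_real \<epsilon> * (\<Sum>x<d P. if x = b then if b = c then 1 else 0 else 0)"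
        unfolding Q_def form_smult[OF proj_of_carrier] form_proj_of using that
        by (intro arg_cong2[of _ _ _ _ times] sum.cong refl) (auto simp: o)
      then have 2: "form n (complex_of_real \<epsilon> \<cdot>\<^sub>m Q) (u P b) (u P c) = (if b = c then complex_of_real \<epsilon> else 0)"
        using that by simp
      from 1 2 show ?thesis unfolding Q by simp
    qed
    then show ?thesis by blast
  qed
  ultimately show ?thesis using *(1) unfolding X_def by blast
qed

section \<open>Rapidly decreasing diagonal operators\<close>

definition diagm :: "nat \<Rightarrow> (nat \<Rightarrow> real) \<Rightarrow> complex mat" where
  "diagm n \<omega> = mat n n (\<lambda>(i, j). if i = j then complex_of_real (\<omega> i) else 0)"

lemma form_diagm: "form n (diagm n \<omega>) u v = (\<Sum>l<n. complex_of_real (\<omega> l) * (cnj (u l) * v l))"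
proof -
  have "form n (diagm n \<omega>) u v = (\<Sum>i<n. \<Sum>j<n. if i = j then complex_of_real (\<omega> i) * (cnj (u i) * v i) else 0)"
    unfolding form_def diagm_def by (intro sum.cong refl) auto
  also have "\<dots> = (\<Sum>i<n. complex_of_real (\<omega> i) * (cnj (u i) * v i))"
    by (intro sum.cong refl) simp
  finally show ?thesis .
qed

lemma form_diagm_self: "form n (diagm n \<omega>) v v = complex_of_real (\<Sum>l<n. \<omega> l * (cmod (v l))\<^sup>2)"
  unfolding form_diagm of_real_sum of_real_mult complex_norm_square
  by (intro sum.cong refl) (simp add: mult.commute)

lemma orthonormal_comb_norm_sum:
  assumes "finite X" "orthonormal n X w"
  shows "(\<Sum>l<n. (cmod (\<Sum>x\<in>X. c x * w x l))\<^sup>2) = (\<Sum>x\<in>X. (cmod (c x))\<^sup>2)"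
  using orthonormal_comb_norm[OF assms, of c] unfolding ip_self of_real_eq_iff .

lemma diagm_code_comb:
  assumes "finite X" "orthonormal n X w"
    and "\<And>x y. x \<in> X \<Longrightarrow> y \<in> X \<Longrightarrow> form n (diagm n \<omega>) (w x) (w y) = (if x = y then complex_of_real \<epsilon> else 0)"
  shows "(\<Sum>l<n. \<omega> l * (cmod (\<Sum>x\<in>X. c x * w x l))\<^sup>2) = \<epsilon> * (\<Sum>x\<in>X. (cmod (c x))\<^sup>2)"
proof -
  let ?v = "\<lambda>l. \<Sum>x\<in>X. c x * w x l"
  have "complex_of_real (\<Sum>l<n. \<omega> l * (cmod (?v l))\<^sup>2) = form n (diagm n \<omega>) ?v ?v"
    unfolding form_diagm_self ..
  also have "\<dots> = (\<Sum>x\<in>X \<inter> X. cnj (c x) * c x * form n (diagm n \<omega>) (w x) (w x))"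
    by (rule form_comb_diagonal[of X]) (use assms in auto)
  also have "\<dots> = complex_of_real (\<epsilon> * (\<Sum>x\<in>X. (cmod (c x))\<^sup>2))"
    unfolding of_real_mult of_real_sum complex_norm_square sum_distrib_left Int_absorb
    by (intro sum.cong refl) (simp add: assms(3) algebra_simps)
  finally show ?thesis unfolding of_real_eq_iff .
qed

text \<open>A larger code would contain a nonzero vector vanishing at all coordinates with
  \<open>\<omega> l \<ge> \<epsilon>\<close>. The value of the form at it would be strictly below
  \<open>\<epsilon>\<close> times its squared norm, contrary to
  \<open>diagm_code_comb\<close>.\<close>

lemma diagm_code_card_le:
  assumes X: "finite X" "orthonormal n X w"
    and eps: "\<And>x y. x \<in> X \<Longrightarrow> y \<in> X \<Longrightarrow> form n (diagm n \<omega>) (w x) (w y) = (if x = y then complex_of_real \<epsilon> else 0)"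
  shows "card X \<le> card {l. l < n \<and> \<omega> l \<ge> \<epsilon>}"
proof (rule ccontr)
  define S where "S = {l. l < n \<and> \<omega> l \<ge> \<epsilon>}"
  have S: "finite S" by (simp add: S_def)
  assume "\<not> ?thesis"
  then have "card S < card X" by (simp add: S_def)
  then obtain c where c: "\<exists>x\<in>X. c x \<noteq> 0" "\<And>l. l \<in> S \<Longrightarrow> (\<Sum>x\<in>X. w x l * c x) = 0"
    using homogeneous_system[OF S X(1), of "\<lambda>l x. w x l"] by blast
  define v where "v l = (\<Sum>x\<in>X. c x * w x l)" for l
  have v0: "v l = 0" if "l \<in> S" for l using c(2)[OF that] by (simp add: v_def mult.commute)
  have "(\<Sum>l<n. (\<epsilon> - \<omega> l) * (cmod (v l))\<^sup>2) = 0"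
    using diagm_code_comb[OF X eps, of c] orthonormal_comb_norm_sum[OF X, of c]
    by (simp add: left_diff_distrib sum_subtractf v_def sum_distrib_left[symmetric])
  moreover have "(\<epsilon> - \<omega> l) * (cmod (v l))\<^sup>2 \<ge> 0" if "l \<in> {..<n}" for l
    using v0[of l] that by (cases "l \<in> S") (auto simp: S_def)
  ultimately have *: "\<forall>l\<in>{..<n}. (\<epsilon> - \<omega> l) * (cmod (v l))\<^sup>2 = 0"
    using sum_nonneg_eq_0_iff[of "{..<n}" "\<lambda>l. (\<epsilon> - \<omega> l) * (cmod (v l))\<^sup>2"] by simp
  have "v l = 0" if "l < n" for l
    using * that v0[of l] by (cases "l \<in> S") (auto simp: S_def)
  then have "(\<Sum>l<n. (cmod (v l))\<^sup>2) = 0" by simp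
  then have "(\<Sum>x\<in>X. (cmod (c x))\<^sup>2) = 0"
    using orthonormal_comb_norm_sum[OF X, of c] by (simp add: v_def)
  then show False using c(1) X(1) by (auto simp: sum_nonneg_eq_0_iff)
qed

lemma cmod_sum_squared_le: "(cmod (\<Sum>x\<in>K. z x))\<^sup>2 \<le> card K * (\<Sum>x\<in>K. (cmod (z x))\<^sup>2)"
proof -
  have "(cmod (\<Sum>x\<in>K. z x))\<^sup>2 \<le> (\<Sum>x\<in>K. cmod (z x))\<^sup>2"
    by (intro power_mono norm_sum) simp
  also have "\<dots> \<le> (\<Sum>x\<in>K. (cmod (z x))\<^sup>2) * (\<Sum>x\<in>K. 1\<^sup>2)"
    using Cauchy_Schwarz_ineq_sum[of "\<lambda>x. cmod (z x)" "\<lambda>_. 1" K] by simp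
  finally show ?thesis by (simp add: mult.commute)
qed

lemma card_residue_class_le:
  "card {l. l \<le> D \<and> l mod m = i} \<le> D div m + 1"
proof -
  have "inj_on (\<lambda>l. l div m) {l. l \<le> D \<and> l mod m = i}"
    by (rule inj_onI) (metis (mono_tags, lifting) div_mult_mod_eq mem_Collect_eq)
  moreover have "(\<lambda>l. l div m) ` {l. l \<le> D \<and> l mod m = i} \<subseteq> {..D div m}"
    by (auto simp: div_le_mono)
  ultimately have "card {l. l \<le> D \<and> l mod m = i} \<le> card {..D div m}"
    by (intro card_inj_on_le) auto
  then show ?thesis by simp
qed

text \<open>If all the codes outside \<open>L\<close> were larger, then by the rank bound the compressions to them of
  all the diagonal operators would be at most \<open>\<mu> (D + 1)\<close>. But these codes together span a vector
  supported on the first \<open>D + 1\<close> coordinates, where the sum of the operators is at least \<open>\<mu> D\<close>.\<close>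
lemma small_code_outside:
  fixes \<mu> :: "nat \<Rightarrow> real"
  assumes K: "finite K" "card K \<le> n" and m: "m \<ge> 1"
    and pos: "\<And>l. \<mu> l > 0" and drop: "\<And>l. n * m * \<mu> (Suc l) < \<mu> l" and anti: "antimono \<mu>"
    and on: "orthonormal n (SIGMA P:K. {..<d P}) (\<lambda>(P, c). u P c)"
    and dn: "(\<Sum>P\<in>K. d P) = n"
    and code: "\<And>i P. i < m \<Longrightarrow> P \<in> K \<Longrightarrow> \<exists>\<epsilon>::real. \<forall>b<d P. \<forall>c<d P.
      form n (diagm n (\<lambda>l. if l mod m = i then \<mu> l else 0)) (u P b) (u P c)
        = (if b = c then complex_of_real \<epsilon> else 0)"
    and L: "L \<subseteq> K" "(\<Sum>P\<in>L. d P) = D" "D < n"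
  shows "\<exists>P\<in>K - L. d P \<le> D div m + 1"
proof (rule ccontr)
  assume "\<not> ?thesis"
  then have big: "d P > D div m + 1" if "P \<in> K - L" for P using that by force
  define \<omega> where "\<omega> i l = (if l mod m = i then \<mu> l else 0)" for i l
  have "\<forall>i P. \<exists>\<epsilon>::real. i < m \<and> P \<in> K \<longrightarrow> (\<forall>b<d P. \<forall>c<d P.
      form n (diagm n (\<omega> i)) (u P b) (u P c) = (if b = c then complex_of_real \<epsilon> else 0))"
    using code unfolding \<omega>_def by blast
  then obtain \<epsilon> where \<epsilon>: "\<And>i P b c. i < m \<Longrightarrow> P \<in> K \<Longrightarrow> b < d P \<Longrightarrow> c < d P \<Longrightarrow>
      form n (diagm n (\<omega> i)) (u P b) (u P c) = (if b = c then complex_of_real (\<epsilon> i P) else 0)"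
    unfolding choice_iff by blast
  have onP: "orthonormal n {..<d P} (u P)" if "P \<in> K" for P
    unfolding orthonormal_def using orthonormalD[OF on] that by fastforce
  \<comment> \<open>Only coordinates \<open>l \<le> D\<close> of residue \<open>i\<close> carry
    entries above \<open>\<mu> (Suc D)\<close>, and there are at most \<open>D div m + 1\<close> of
    them; a larger \<open>\<epsilon> i P\<close> would therefore bound \<open>d P\<close> against
    \<open>big\<close>.\<close>
  have small: "\<epsilon> i P \<le> \<mu> (Suc D)" if i: "i < m" and P: "P \<in> K - L" for i P
  proof (rule ccontr)
    assume gt: "\<not> \<epsilon> i P \<le> \<mu> (Suc D)"
    have "card {..<d P} \<le> card {l. l < n \<and> \<omega> i l \<ge> \<epsilon> i P}"
      by (rule diagm_code_card_le[OF _ onP]) (use P \<epsilon>[OF i] in auto)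
    also have "\<dots> \<le> card {l. l \<le> D \<and> l mod m = i}"
    proof (intro card_mono subsetI)
      fix l assume "l \<in> {l. l < n \<and> \<omega> i l \<ge> \<epsilon> i P}"
      then have "\<omega> i l > \<mu> (Suc D)" using gt by auto
      then have "l mod m = i" "\<mu> l > \<mu> (Suc D)"
        using pos[of "Suc D"] by (auto simp: \<omega>_def split: if_splits)
      moreover have "l \<le> D"
        using antimonoD[OF anti, of "Suc D" l] \<open>\<mu> l > \<mu> (Suc D)\<close> by (cases "l \<le> D") auto
      ultimately show "l \<in> {l. l \<le> D \<and> l mod m = i}" by simp
    qed simp
    also have "\<dots> \<le> D div m + 1" by (rule card_residue_class_le)
    finally show False using big[OF P] by simp
  qed
  define J where "J = (SIGMA P:K - L. {..<d P})"
  have J: "finite J" using K(1) by (simp add: J_def)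
  have onJ: "orthonormal n J (\<lambda>(P, c). u P c)"
    using on unfolding orthonormal_def J_def by blast
  \<comment> \<open>The \<open>n - D\<close> basis vectors outside \<open>L\<close> outnumber the
    coordinates beyond \<open>D\<close> by one, so some nontrivial combination vanishes at all of
    these.\<close>
  have "card J = n - D"
    using K(1) L dn sum_diff_nat[OF finite_subset[OF L(1) K(1)] L(1), of d] by (simp add: J_def)
  then have cardJ: "card {Suc D..<n} < card J" using L(3) by simp
  obtain c where c: "\<exists>x\<in>J. c x \<noteq> 0"
    "\<And>l. l \<in> {Suc D..<n} \<Longrightarrow> (\<Sum>x\<in>J. (case x of (P, b) \<Rightarrow> u P b) l * c x) = 0"
    using homogeneous_system[OF _ J cardJ, of "\<lambda>l x. (case x of (P, b) \<Rightarrow> u P b) l"] by blast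
  define v where "v l = (\<Sum>x\<in>J. c x * (case x of (P, b) \<Rightarrow> u P b) l)" for l
  define vP where "vP P l = (\<Sum>b<d P. c (P, b) * u P b l)" for P l
  define s where "s = (\<Sum>x\<in>J. (cmod (c x))\<^sup>2)"
  have "s > 0"
  proof -
    obtain x where "x \<in> J" "c x \<noteq> 0" using c(1) by blast
    then show ?thesis unfolding s_def by (intro sum_pos2[OF J, of x]) auto
  qed
  have v0: "v l = 0" if "D < l" "l < n" for l
    using c(2)[of l] that by (simp add: v_def mult.commute)
  have v_split: "v l = (\<Sum>P\<in>K - L. vP P l)" for l
    unfolding v_def J_def vP_def using K(1) by (subst sum.Sigma) (auto intro!: sum.cong)
  have s_split: "s = (\<Sum>P\<in>K - L. \<Sum>b<d P. (cmod (c (P, b)))\<^sup>2)"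
    unfolding s_def J_def using K(1) by (subst sum.Sigma) (auto intro!: sum.cong)
  \<comment> \<open>Two estimates of the form of the summed operators at \<open>v\<close>. From
    below, \<open>v\<close> lives on the coordinates \<open>l \<le> D\<close>. From above, splitting
    \<open>v\<close> over at most \<open>n\<close> codes costs a factor \<open>n\<close> and summing
    over the operators a factor \<open>m\<close>; \<open>drop\<close> makes the two
    incompatible.\<close>
  have "\<mu> D * s = (\<Sum>l<n. \<mu> D * (cmod (v l))\<^sup>2)"
    using orthonormal_comb_norm_sum[OF J onJ, of c]
    unfolding sum_distrib_left[symmetric] s_def v_def by simp
  also have "\<dots> \<le> (\<Sum>l<n. \<mu> l * (cmod (v l))\<^sup>2)"
  proof (rule sum_mono)
    fix l assume "l \<in> {..<n}"
    then show "\<mu> D * (cmod (v l))\<^sup>2 \<le> \<mu> l * (cmod (v l))\<^sup>2"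
      using v0[of l] antimonoD[OF anti, of l D] by (cases "l \<le> D") (auto intro: mult_right_mono)
  qed
  also have "\<dots> \<le> (\<Sum>l<n. \<mu> l * (n * (\<Sum>P\<in>K - L. (cmod (vP P l))\<^sup>2)))"
  proof (rule sum_mono)
    fix l
    have "card (K - L) \<le> n" using K card_mono[of K "K - L"] by auto
    have "(cmod (v l))\<^sup>2 \<le> card (K - L) * (\<Sum>P\<in>K - L. (cmod (vP P l))\<^sup>2)"
      unfolding v_split by (rule cmod_sum_squared_le)
    also have "\<dots> \<le> n * (\<Sum>P\<in>K - L. (cmod (vP P l))\<^sup>2)"
      using \<open>card (K - L) \<le> n\<close> by (intro mult_right_mono sum_nonneg) auto
    finally show "\<mu> l * (cmod (v l))\<^sup>2 \<le> \<mu> l * (n * (\<Sum>P\<in>K - L. (cmod (vP P l))\<^sup>2))"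
      using pos[of l] by (intro mult_left_mono) auto
  qed
  also have "\<dots> = n * (\<Sum>P\<in>K - L. \<Sum>l<n. \<mu> l * (cmod (vP P l))\<^sup>2)"
    unfolding sum_distrib_left by (subst sum.swap) (intro sum.cong refl, simp add: algebra_simps)
  also have "\<dots> \<le> n * (\<Sum>P\<in>K - L. m * \<mu> (Suc D) * (\<Sum>b<d P. (cmod (c (P, b)))\<^sup>2))"
  proof (intro mult_left_mono sum_mono)
    fix P assume P: "P \<in> K - L"
    have \<omega>_sum: "(\<Sum>i<m. \<omega> i l) = \<mu> l" for l using m by (simp add: \<omega>_def)
    have "(\<Sum>l<n. \<mu> l * (cmod (vP P l))\<^sup>2) = (\<Sum>i<m. \<Sum>l<n. \<omega> i l * (cmod (vP P l))\<^sup>2)"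
      by (subst sum.swap) (simp add: sum_distrib_right[symmetric] \<omega>_sum)
    also have "\<dots> = (\<Sum>i<m. \<epsilon> i P * (\<Sum>b<d P. (cmod (c (P, b)))\<^sup>2))"
      unfolding vP_def using P by (intro sum.cong refl diagm_code_comb onP) (auto simp: \<epsilon>)
    also have "\<dots> \<le> (\<Sum>i<m. \<mu> (Suc D) * (\<Sum>b<d P. (cmod (c (P, b)))\<^sup>2))"
      using small[OF _ P] by (intro sum_mono mult_right_mono sum_nonneg) auto
    finally show "(\<Sum>l<n. \<mu> l * (cmod (vP P l))\<^sup>2) \<le> m * \<mu> (Suc D) * (\<Sum>b<d P. (cmod (c (P, b)))\<^sup>2)"
      by simp
  qed simp
  also have "\<dots> = n * m * \<mu> (Suc D) * s"
    unfolding s_split sum_distrib_left[symmetric] by simp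
  also have "\<dots> < \<mu> D * s" using drop \<open>s > 0\<close> by (intro mult_strict_right_mono) auto
  finally show False by simp
qed

section \<open>From code dimensions to the step logarithm\<close>

text \<open>The largest total dimension that \<open>k\<close> codes can reach if each has dimension
  at most \<open>D div m + 1\<close>, where \<open>D\<close> is the total of those before
  it.\<close>

primrec cover_bound :: "nat \<Rightarrow> nat \<Rightarrow> nat" where
  "cover_bound m 0 = 0"
| "cover_bound m (Suc k) = cover_bound m k + cover_bound m k div m + 1"

text \<open>Codes are picked one at a time, each small relative to the total before it; the bound
  propagates because \<open>D + D div m + 1\<close> is monotone in \<open>D\<close>.\<close>

lemma sum_le_cover_bound:
  fixes d :: "'p \<Rightarrow> nat"
  assumes K: "finite K"
    and step: "\<And>L. L \<subseteq> K \<Longrightarrow> sum d L < sum d K \<Longrightarrow> \<exists>P\<in>K - L. d P \<le> sum d L div m + 1"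
  shows "sum d K \<le> cover_bound m (card K)"
proof -
  have "k \<le> card K \<Longrightarrow> \<exists>L\<subseteq>K. card L = k \<and> sum d L \<le> cover_bound m k" for k
  proof (induction k)
    case (Suc k)
    then obtain L where L: "L \<subseteq> K" "card L = k" "sum d L \<le> cover_bound m k" by auto
    have fL: "finite L" using L(1) K by (rule finite_subset)
    have "\<exists>P\<in>K - L. d P \<le> sum d L div m + 1"
    proof (cases "sum d L < sum d K")
      \<comment> \<open>Here \<open>L\<close> already has the full total, so all codes left have
        dimension zero and any of them will do.\<close>
      case False
      have "L \<noteq> K" using L(2) Suc.prems by auto
      then obtain P where P: "P \<in> K - L" using L(1) by auto
      then have "d P + sum d L = sum d (insert P L)" using fL by simp
      also have "\<dots> \<le> sum d K" using K L(1) P by (intro sum_mono2) auto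
      finally have "d P \<le> sum d L div m + 1" using False by simp
      then show ?thesis using P by blast
    next
      case True
      then show ?thesis by (rule step[OF L(1)])
    qed
    then obtain P where P: "P \<in> K - L" "d P \<le> sum d L div m + 1" by blast
    have "sum d (insert P L) \<le> cover_bound m (Suc k)"
      using P fL L(3) div_le_mono[OF L(3), of m] by simp
    moreover have "card (insert P L) = Suc k" using P fL L(2) by simp
    ultimately show ?case using P L(1) by (intro exI[of _ "insert P L"]) auto
  qed (rule exI[of _ "{}"], simp)
  from this[OF order_refl] obtain L where L: "L \<subseteq> K" "card L = card K" "sum d L \<le> cover_bound m (card K)"
    by (elim exE conjE)
  have "L = K" by (rule card_subset_eq[OF K L(1,2)])
  with L(3) show ?thesis by simp
qed

text \<open>A step of \<open>slog\<close> undoes a step of \<open>cover_bound\<close>: if removing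
  \<open>r\<close> from \<open>p \<le> h + h div m + 1\<close> left more than \<open>h\<close>, then
  \<open>p \<le> r * (m + 1)\<close> would give \<open>h < m * r\<close>, so
  \<open>h div m < r\<close>, and \<open>p\<close> would exceed its bound.\<close>

lemma slog_le_of_le_cover_bound:
  assumes "m \<ge> 1"
  shows "p \<le> cover_bound m k \<Longrightarrow> slog p (m + 1) \<le> k"
proof (induction k arbitrary: p)
  case (Suc k)
  show ?case
  proof (cases "p = 0")
    case False
    define r where "r = nat \<lceil>real p / real (m + 1)\<rceil>"
    have r: "r \<ge> 1" "r \<le> p" "p \<le> r * (m + 1)"
      unfolding r_def by (rule ceiling_quotient_bounds; use False in simp)+
    define h where "h = cover_bound m k"
    have "p - r \<le> h"
    proof (rule ccontr)
      assume "\<not> p - r \<le> h"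
      then have 1: "h + 1 + r \<le> p" by simp
      then have "h + 1 \<le> m * r" using r(3) by (simp add: algebra_simps)
      then have "h < m * r" by simp
      then have "h div m < r" using assms by (simp add: div_less_iff_less_mult mult.commute)
      then show False using 1 Suc.prems by (simp add: h_def)
    qed
    from Suc.IH[OF this[unfolded h_def]] show ?thesis
      using slog_step[of p "m + 1"] False by (simp add: r_def)
  qed simp
qed simp

lemma slog_le: "slog p q \<le> p"
proof (cases "q = 0")
  case False
  show ?thesis
  proof (induction p rule: less_induct)
    case (less p)
    show ?case
    proof (cases "p = 0")
      case p: False
      define r where "r = nat \<lceil>real p / real q\<rceil>"
      have r: "r \<ge> 1" unfolding r_def by (rule ceiling_quotient_bounds) (use p False in auto)
      have "slog (p - r) q \<le> p - r" by (rule less) (use p r in simp)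
      then show ?thesis using slog_step[of p q] p False r by (simp add: r_def)
    qed simp
  qed
qed (subst slog.simps, simp)

text \<open>Each step removes exactly one. This makes the lower bound constant in \<open>m\<close>
  from \<open>m = n\<close> on.\<close>

lemma slog_eq_self: "p \<le> q \<Longrightarrow> slog p q = p"
proof (induction p)
  case (Suc p)
  define r where "r = nat \<lceil>real (Suc p) / real q\<rceil>"
  have r: "r \<ge> 1" "(r - 1) * q < Suc p"
    unfolding r_def by (rule ceiling_quotient_bounds; use Suc.prems in simp)+
  have "r = 1"
  proof (rule ccontr)
    assume "r \<noteq> 1"
    then have "1 * q \<le> (r - 1) * q" using r(1) by (intro mult_right_mono) auto
    then show False using r(2) Suc.prems by linarith
  qed
  then show ?case using slog_step[of "Suc p" q] Suc by (simp add: r_def)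
qed simp

text \<open>The rate at which \<open>\<mu>\<close> drops is calibrated for colourings with at most
  \<open>n\<close> members; a larger colouring satisfies the bound by
  \<open>slog_le\<close>.\<close>

lemma coloring_card_ge:
  fixes \<mu> :: "nat \<Rightarrow> real"
  assumes col: "is_coloring n E K" and E: "\<And>A. A \<in> E \<Longrightarrow> A \<in> carrier_mat n n" and m: "m \<ge> 1"
    and pos: "\<And>l. \<mu> l > 0" and drop: "\<And>l. n * m * \<mu> (Suc l) < \<mu> l" and anti: "antimono \<mu>"
    and diag: "\<And>i. i < m \<Longrightarrow> diagm n (\<lambda>l. if l mod m = i then \<mu> l else 0) \<in> E"
  shows "slog n (m + 1) \<le> card K"
proof (cases "card K \<le> n")
  case True
  have K: "finite K" using col by (simp add: is_coloring_def)
  have "\<exists>d u. orthonormal n (SIGMA P:K. {..<d P}) (\<lambda>(P, c). u P c) \<and> (\<Sum>P\<in>K. d P) = n \<and>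
    (\<forall>A\<in>E. \<forall>P\<in>K. \<exists>\<epsilon>::real. \<forall>b<d P. \<forall>c<d P.
      form n A (u P b) (u P c) = (if b = c then complex_of_real \<epsilon> else 0))"
    by (rule coloring_basis[OF col]) (rule E)
  then obtain d u where
    on: "orthonormal n (SIGMA P:K. {..<d P}) (\<lambda>(P, c). u P c)" and dn: "(\<Sum>P\<in>K. d P) = n"
    and code: "\<forall>A\<in>E. \<forall>P\<in>K. \<exists>\<epsilon>::real. \<forall>b<d P. \<forall>c<d P.
      form n A (u P b) (u P c) = (if b = c then complex_of_real \<epsilon> else 0)"
    by (elim exE conjE)
  have "sum d K \<le> cover_bound m (card K)"
  proof (rule sum_le_cover_bound[OF K])
    fix L assume L: "L \<subseteq> K" "sum d L < sum d K"
    show "\<exists>P\<in>K - L. d P \<le> sum d L div m + 1"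
    proof (rule small_code_outside[OF K True m pos drop anti on dn _ L(1) refl])
      show "sum d L < n" using L(2) dn by simp
      fix i P assume i: "i < m" and P: "P \<in> K"
      from bspec[OF bspec[OF code diag[OF i]] P]
      show "\<exists>\<epsilon>::real. \<forall>b<d P. \<forall>c<d P.
        form n (diagm n (\<lambda>l. if l mod m = i then \<mu> l else 0)) (u P b) (u P c)
          = (if b = c then complex_of_real \<epsilon> else 0)" .
    qed
  qed
  then show ?thesis using slog_le_of_le_cover_bound[OF m] dn by simp
next
  case False
  then show ?thesis using slog_le[of n "m + 1"] by simp
qed

section \<open>Quantum graphs with large chromatic number\<close>

lemma self_adjointI:
  assumes "A \<in> carrier_mat n n" "\<And>i j. i < n \<Longrightarrow> j < n \<Longrightarrow> cnj (A $$ (j, i)) = A $$ (i, j)"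
  shows "self_adjoint n A"
  unfolding self_adjoint_def
proof
  show "mat_adjoint A = A"
    by (rule eq_matI) (use assms mat_adjoint_carrier[OF assms(1)] in \<open>auto simp: mat_adjoint_index\<close>)
qed fact

lemma self_adjoint_index:
  assumes "self_adjoint n A" "i < n" "j < n"
  shows "cnj (A $$ (j, i)) = A $$ (i, j)"
  using mat_adjoint_index[of A n i j] assms by (simp add: self_adjoint_def)

lemma self_adjoint_real_lincomb:
  assumes "\<And>k. k < length bs \<Longrightarrow> self_adjoint n (bs ! k)"
  shows "self_adjoint n (real_lincomb n c bs)"
  by (rule self_adjointI) (use self_adjoint_index[OF assms] in \<open>simp_all add: real_lincomb_def cnj_sum\<close>)

lemma real_lincomb_index:
  "i < n \<Longrightarrow> j < n \<Longrightarrow> real_lincomb n c bs $$ (i, j) = (\<Sum>k<length bs. complex_of_real (c k) * (bs ! k) $$ (i, j))"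
  by (simp add: real_lincomb_def)

lemma quantum_graph_span:
  assumes "length bs = m + 1" and sa: "\<And>k. k < m + 1 \<Longrightarrow> self_adjoint n (bs ! k)"
    and one: "1\<^sub>m n = real_lincomb n c0 bs"
    and indep: "\<And>c k. real_lincomb n c bs = 0\<^sub>m n n \<Longrightarrow> k < m + 1 \<Longrightarrow> c k = 0"
  shows "quantum_graph n m {real_lincomb n c bs | c. True}"
proof -
  have "set bs \<subseteq> carrier_mat n n"
    using sa assms(1) by (auto simp: set_conv_nth self_adjoint_def)
  then have "real_space_dim n {real_lincomb n c bs | c. True} (m + 1)"
    unfolding real_space_dim_def using assms(1) indep by blast
  moreover have "self_adjoint n A" if "A \<in> {real_lincomb n c bs | c. True}" for A
    using that self_adjoint_real_lincomb[of bs n] sa assms(1) by auto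
  ultimately show ?thesis unfolding quantum_graph_def using one by blast
qed

lemma self_adjoint_diagm: "self_adjoint n (diagm n \<omega>)"
  by (rule self_adjointI) (auto simp: diagm_def)

lemma diagm_one: "diagm n (\<lambda>_. 1) = 1\<^sub>m n"
  by (rule eq_matI) (auto simp: diagm_def)

text \<open>Independence is read off the diagonal. For \<open>m \<ge> 1\<close> the coordinates
  \<open>0\<close> and \<open>m\<close>, both available because \<open>m < n\<close>, lie in the
  same residue class but carry different values of \<open>\<mu>\<close>, which forces
  \<open>c 0\<close> and \<open>c (Suc 0)\<close> to vanish; then coordinate \<open>i\<close> gives
  \<open>c (Suc i) = 0\<close>.\<close>

lemma diagonal_graph_exists:
  fixes \<mu> :: "nat \<Rightarrow> real"
  assumes mn: "m < n" and pos: "\<And>l. \<mu> l > 0" and inj: "inj \<mu>"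
  shows "\<exists>E. quantum_graph n m E \<and> (\<forall>i<m. diagm n (\<lambda>l. if l mod m = i then \<mu> l else 0) \<in> E)"
proof -
  define \<omega> where "\<omega> i l = (if l mod m = i then \<mu> l else 0)" for i l
  define bs where "bs = diagm n (\<lambda>_. 1) # map (\<lambda>i. diagm n (\<omega> i)) [0..<m]"
  have len: "length bs = m + 1" by (simp add: bs_def)
  have bs0: "bs ! 0 = diagm n (\<lambda>_. 1)" by (simp add: bs_def)
  have bsS: "bs ! Suc i = diagm n (\<omega> i)" if "i < m" for i using that by (simp add: bs_def)
  have bs_form: "\<exists>\<omega>. bs ! k = diagm n \<omega>" if "k < m + 1" for k
    using that bs0 bsS by (cases k) auto
  have in_span: "bs ! k = real_lincomb n (\<lambda>j. if j = k then 1 else 0) bs" if "k < m + 1" for k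
  proof (rule eq_matI)
    fix i j assume "i < dim_row (real_lincomb n (\<lambda>j. if j = k then 1 else 0) bs)"
      "j < dim_col (real_lincomb n (\<lambda>j. if j = k then 1 else 0) bs)"
    then have ij: "i < n" "j < n" by (auto simp: real_lincomb_def)
    have "real_lincomb n (\<lambda>j. if j = k then 1 else 0) bs $$ (i, j)
        = (\<Sum>l<m + 1. if l = k then (bs ! k) $$ (i, j) else 0)"
      unfolding real_lincomb_index[OF ij] len by (intro sum.cong refl) auto
    then show "(bs ! k) $$ (i, j) = real_lincomb n (\<lambda>j. if j = k then 1 else 0) bs $$ (i, j)"
      using that by simp
  qed (use bs_form[OF that] in \<open>auto simp: real_lincomb_def diagm_def\<close>)
  have "quantum_graph n m {real_lincomb n c bs | c. True}"
  proof (rule quantum_graph_span[OF len])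
    show "self_adjoint n (bs ! k)" if "k < m + 1" for k
      using bs_form[OF that] self_adjoint_diagm by auto
    show "1\<^sub>m n = real_lincomb n (\<lambda>j. if j = 0 then 1 else 0) bs"
      using in_span[of 0] bs0 diagm_one by simp
    fix c k assume z: "real_lincomb n c bs = 0\<^sub>m n n" and k: "k < m + 1"
    have entry: "c 0 + (\<Sum>i<m. c (Suc i) * \<omega> i l) = 0" if l: "l < n" for l
    proof -
      have "(\<Sum>k<Suc m. complex_of_real (c k) * (bs ! k) $$ (l, l)) = 0"
        using z real_lincomb_index[OF l l, of c bs] l len by simp
      then have "complex_of_real (c 0) * (bs ! 0) $$ (l, l)
          + (\<Sum>i<m. complex_of_real (c (Suc i)) * (bs ! Suc i) $$ (l, l)) = 0"
        by (subst (asm) sum.lessThan_Suc_shift)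
      moreover have "(\<Sum>i<m. complex_of_real (c (Suc i)) * (bs ! Suc i) $$ (l, l))
          = complex_of_real (\<Sum>i<m. c (Suc i) * \<omega> i l)"
        unfolding of_real_sum using l by (intro sum.cong refl) (simp add: bsS diagm_def)
      ultimately have "complex_of_real (c 0 + (\<Sum>i<m. c (Suc i) * \<omega> i l)) = 0"
        using l by (simp add: bs0 diagm_def)
      then show ?thesis by (simp only: of_real_eq_0_iff)
    qed
    show "c k = 0"
    proof (cases "m = 0")
      case True
      then show ?thesis using entry[of 0] mn k by simp
    next
      case False
      have entry': "c 0 + c (Suc (l mod m)) * \<mu> l = 0" if "l < n" for l
      proof -
        have "(\<Sum>i<m. c (Suc i) * \<omega> i l) = (\<Sum>i<m. if i = l mod m then c (Suc i) * \<mu> l else 0)"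
          by (intro sum.cong refl) (auto simp: \<omega>_def)
        then show ?thesis using entry[OF that] False by simp
      qed
      have "c 0 + c (Suc 0) * \<mu> 0 = 0" "c 0 + c (Suc 0) * \<mu> m = 0"
        using entry'[of 0] entry'[of m] mn by simp_all
      then have "c (Suc 0) * \<mu> 0 = c (Suc 0) * \<mu> m" by linarith
      moreover have "\<mu> 0 \<noteq> \<mu> m" using inj False by (metis injD)
      ultimately have "c (Suc 0) = 0" by simp
      then have c0: "c 0 = 0" using entry'[of 0] mn by simp
      show ?thesis
      proof (cases k)
        case (Suc i)
        then show ?thesis using entry'[of i] k mn c0 pos[of i] by simp
      qed (simp add: c0)
    qed
  qed
  moreover have "diagm n (\<omega> i) \<in> {real_lincomb n c bs | c. True}" if "i < m" for i
    using in_span[of "Suc i"] bsS[OF that] that by auto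
  ultimately show ?thesis unfolding \<omega>_def by blast
qed

text \<open>The standard real basis of the Hermitian matrices, indexed by pairs: those with
  \<open>a \<le> b\<close> give the real symmetric members, the others the imaginary ones. Each pair
  is thereby detected by the real or the imaginary part of a single entry.\<close>

definition herm_unit :: "nat \<Rightarrow> nat \<times> nat \<Rightarrow> complex mat" where
  "herm_unit n = (\<lambda>(a, b). mat n n (\<lambda>(i, j).
     if a \<le> b then (if (i, j) = (a, b) \<or> (i, j) = (b, a) then 1 else 0)
     else if (i, j) = (a, b) then \<i> else if (i, j) = (b, a) then - \<i> else 0))"

lemma self_adjoint_herm_unit: "self_adjoint n (herm_unit n p)"
  by (rule self_adjointI) (auto simp: herm_unit_def split: prod.split)

lemma Re_herm_unit:
  "a \<le> b \<Longrightarrow> b < n \<Longrightarrow> Re (herm_unit n p $$ (a, b)) = (if p = (a, b) then 1 else 0)"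
  by (cases p) (auto simp: herm_unit_def)

lemma Im_herm_unit:
  "b < a \<Longrightarrow> a < n \<Longrightarrow> Im (herm_unit n p $$ (a, b)) = (if p = (a, b) then 1 else 0)"
  by (cases p) (auto simp: herm_unit_def)

lemma herm_unit_diag:
  "i < n \<Longrightarrow> j < n \<Longrightarrow> herm_unit n (a, a) $$ (i, j) = (if i = a \<and> j = a then 1 else 0)"
  by (auto simp: herm_unit_def)

text \<open>At this valence there is room for all diagonal matrices: the \<open>n\<close> diagonal
  units are completed by further Hermitian units to \<open>m + 1\<close> of them. Independence is
  seen at the entry \<open>(a, b)\<close> belonging to each coefficient.\<close>

lemma hermitian_graph_exists:
  assumes nm: "n \<le> m + 1" "m + 1 \<le> n\<^sup>2"
  shows "\<exists>E. quantum_graph n m E \<and> (\<forall>\<omega>. diagm n \<omega> \<in> E)"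
proof -
  define D where "D = (\<lambda>i. (i, i)) ` {..<n}"
  have D: "D \<subseteq> {..<n} \<times> {..<n}" "card D = n"
    by (auto simp: D_def card_image inj_on_def)
  have "n \<le> m + 1" "m + 1 \<le> card ({..<n} \<times> {..<n})" using nm by (simp_all add: power2_eq_square)
  then obtain S where S: "D \<subseteq> S" "S \<subseteq> {..<n} \<times> {..<n}" "card S = m + 1"
    using exists_subset_between[of D "m + 1" "{..<n} \<times> {..<n}"] D by auto
  have "finite S" using S(2) by (rule finite_subset) simp
  then obtain xs where xs: "set xs = S" "distinct xs" using finite_distinct_list by blast
  have len: "length xs = m + 1" using xs S(3) distinct_card by fastforce
  define bs where "bs = map (herm_unit n) xs"
  have len': "length bs = m + 1" by (simp add: bs_def len)
  have diag: "diagm n \<omega> = real_lincomb n (\<lambda>k. if fst (xs ! k) = snd (xs ! k) then \<omega> (fst (xs ! k)) else 0) bs"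
    (is "_ = real_lincomb n ?c bs") for \<omega>
  proof (rule eq_matI)
    fix i j assume "i < dim_row (real_lincomb n ?c bs)" "j < dim_col (real_lincomb n ?c bs)"
    then have ij: "i < n" "j < n" by (auto simp: real_lincomb_def)
    have "(i, i) \<in> S" using S(1) ij(1) by (auto simp: D_def)
    define f where "f p = complex_of_real (if fst p = snd p then \<omega> (fst p) else 0) * herm_unit n p $$ (i, j)" for p
    have "real_lincomb n ?c bs $$ (i, j) = (\<Sum>k<length xs. f (xs ! k))"
      unfolding real_lincomb_index[OF ij] by (simp add: bs_def f_def)
    also have "\<dots> = (\<Sum>p\<in>S. f p)"
      by (rule sum.reindex_bij_betw) (rule bij_betw_nth[OF xs(2) refl xs(1)[symmetric]])
    also have "\<dots> = (\<Sum>p\<in>S. if p = (i, i) then if i = j then complex_of_real (\<omega> i) else 0 else 0)"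
    proof (intro sum.cong refl)
      fix p :: "nat \<times> nat"
      obtain a b where "p = (a, b)" by (cases p)
      then show "f p = (if p = (i, i) then if i = j then complex_of_real (\<omega> i) else 0 else 0)"
        using ij by (cases "a = b") (auto simp: f_def herm_unit_diag)
    qed
    also have "(\<Sum>p\<in>S. if p = (i, i) then if i = j then complex_of_real (\<omega> i) else 0 else 0)
        = diagm n \<omega> $$ (i, j)"
      using \<open>finite S\<close> \<open>(i, i) \<in> S\<close> ij by (simp add: diagm_def)
    finally show "diagm n \<omega> $$ (i, j) = real_lincomb n ?c bs $$ (i, j)" by simp
  qed (auto simp: real_lincomb_def diagm_def)
  have "quantum_graph n m {real_lincomb n c bs | c. True}"
  proof (rule quantum_graph_span[OF len'])
    show "self_adjoint n (bs ! k)" if "k < m + 1" for k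
      using that by (simp add: bs_def len self_adjoint_herm_unit)
    show "1\<^sub>m n = real_lincomb n (\<lambda>k. if fst (xs ! k) = snd (xs ! k) then 1 else 0) bs"
      using diag[of "\<lambda>_. 1"] by (simp add: diagm_one)
    fix c k assume z: "real_lincomb n c bs = 0\<^sub>m n n" and k: "k < m + 1"
    obtain a b where ab: "xs ! k = (a, b)" by (cases "xs ! k")
    then have "(a, b) \<in> S" using xs(1) k len by (metis nth_mem)
    then have lt: "a < n" "b < n" using S(2) by auto
    have ind: "(\<Sum>j<m + 1. c j * (if xs ! j = (a, b) then 1 else 0)) = c k"
    proof -
      have "(\<Sum>j<m + 1. c j * (if xs ! j = (a, b) then 1 else 0)) = (\<Sum>j<m + 1. if j = k then c k else 0)"
        unfolding ab[symmetric] using xs(2) k len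
        by (intro sum.cong refl) (auto simp: nth_eq_iff_index_eq)
      then show ?thesis using k by simp
    qed
    have 0: "(\<Sum>j<m + 1. complex_of_real (c j) * herm_unit n (xs ! j) $$ (a, b)) = 0"
    proof -
      have "(\<Sum>j<m + 1. complex_of_real (c j) * herm_unit n (xs ! j) $$ (a, b)) = real_lincomb n c bs $$ (a, b)"
        unfolding real_lincomb_index[OF lt] len' by (intro sum.cong refl) (simp add: bs_def len)
      then show ?thesis using z lt by simp
    qed
    show "c k = 0"
    proof (cases "a \<le> b")
      case True
      then show ?thesis using arg_cong[OF 0, of Re] ind lt by (simp add: Re_herm_unit del: sum.lessThan_Suc)
    next
      case False
      then show ?thesis using arg_cong[OF 0, of Im] ind lt by (simp add: Im_herm_unit del: sum.lessThan_Suc)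
    qed
  qed
  moreover have "diagm n \<omega> \<in> {real_lincomb n c bs | c. True}" for \<omega>
    by (intro CollectI exI conjI TrueI) (rule diag)
  ultimately show ?thesis by (intro exI conjI allI)
qed

lemma chromatic_number_attained:
  assumes "quantum_graph n m E"
  shows "\<exists>K. is_coloring n E K \<and> card K = chromatic_number n E"
  unfolding chromatic_number_def
  by (rule LeastI_ex[of "\<lambda>k. \<exists>K. is_coloring n E K \<and> card K = k"])
    (use coloring_exists[OF assms] in blast)

lemma high_chromatic_graph_exists:
  assumes n: "1 \<le> n" and m: "m \<le> n\<^sup>2 - 1"
  shows "\<exists>E. quantum_graph n m E \<and> slog n (m + 1) \<le> chromatic_number n E"
proof -
  \<comment> \<open>For \<open>m \<ge> n\<close>, residues modulo \<open>n\<close> already separate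
    all the coordinates, and \<open>slog n (m + 1)\<close> and \<open>slog n (n + 1)\<close> are
    both \<open>n\<close>.\<close>
  define k where "k = min m n"
  \<comment> \<open>Any base above \<open>n * k\<close> gives the required drop; the
    \<open>2\<close> keeps \<open>R > 1\<close> also for \<open>k = 0\<close>.\<close>
  define R where "R = real (n * k + 2)"
  define \<mu> where "\<mu> l = (1 / R) ^ l" for l
  have nk: "real n * real k < R" by (simp add: R_def)
  have R: "R > 1"
    unfolding R_def of_nat_add using of_nat_0_le_iff[of "n * k", where ?'a = real] by linarith
  have pos: "\<mu> l > 0" for l using R by (simp add: \<mu>_def)
  have drop: "real n * real k * \<mu> (Suc l) < \<mu> l" for l
  proof -
    have "real n * real k * \<mu> (Suc l) = (real n * real k / R) * \<mu> l" by (simp add: \<mu>_def)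
    also have "\<dots> < 1 * \<mu> l" using R pos nk by (intro mult_strict_right_mono) (auto simp: divide_less_eq)
    finally show ?thesis by simp
  qed
  have anti: "antimono \<mu>"
    unfolding \<mu>_def using R by (intro antimonoI power_decreasing) auto
  have "inj \<mu>"
    unfolding \<mu>_def using R by (intro injI) (simp add: power_inject_exp')
  have n2: "n \<le> n\<^sup>2" using n by (simp add: power2_eq_square)
  obtain E where E: "quantum_graph n m E"
    "\<And>i. i < k \<Longrightarrow> diagm n (\<lambda>l. if l mod k = i then \<mu> l else 0) \<in> E"
  proof (cases "m < n")
    case True
    then have "k = m" by (simp add: k_def)
    obtain E where "quantum_graph n m E"
      "\<forall>i<m. diagm n (\<lambda>l. if l mod m = i then \<mu> l else 0) \<in> E"
      using diagonal_graph_exists[OF True pos \<open>inj \<mu>\<close>] by (elim exE conjE)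
    then show thesis by (intro that[of E]) (simp_all add: \<open>k = m\<close>)
  next
    case False
    have "n \<le> m + 1" using False by simp
    moreover have "m + 1 \<le> n\<^sup>2" using m n n2 by linarith
    ultimately have "\<exists>E. quantum_graph n m E \<and> (\<forall>\<omega>. diagm n \<omega> \<in> E)"
      by (rule hermitian_graph_exists)
    then obtain E where "quantum_graph n m E" "\<forall>\<omega>. diagm n \<omega> \<in> E"
      by (elim exE conjE)
    then show thesis by (intro that[of E]) auto
  qed
  have Ec: "A \<in> carrier_mat n n" if "A \<in> E" for A
    using E(1) that by (auto simp: quantum_graph_def self_adjoint_def)
  obtain K where K: "is_coloring n E K" "card K = chromatic_number n E"
    using chromatic_number_attained[OF E(1)] by blast
  have slog_k: "slog n (m + 1) = slog n (k + 1)"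
    by (cases "m < n") (simp_all add: k_def slog_eq_self)
  have "slog n (k + 1) \<le> card K"
  proof (cases "k = 0")
    \<comment> \<open>Now \<open>m = 0\<close>, and the family of diagonal operators is empty. A
      colouring has at least one member, and \<open>slog n 1 = 1\<close>.\<close>
    case True
    have "K \<noteq> {}"
    proof
      assume "K = {}"
      moreover have "(\<Sum>P\<in>K. P $$ (0, 0)) = 1\<^sub>m n $$ (0, 0)"
        using K(1) n by (simp add: is_coloring_def)
      ultimately show False using n by simp
    qed
    moreover have "finite K" using K(1) by (simp add: is_coloring_def)
    ultimately have "1 \<le> card K" by (simp add: Suc_le_eq card_gt_0_iff)
    moreover have "slog n 1 = 1" using slog_step[of n 1] n by simp
    ultimately show ?thesis using True by simp
  next
    case False
    then show ?thesis
      by (intro coloring_card_ge[OF K(1) _ _ pos drop anti]) (simp_all add: Ec E(2))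
  qed
  then show ?thesis using E(1) K(2) slog_k by auto
qed

section \<open>Growth of the step logarithm and the bounds for \<open>chi\<close>\<close>

text \<open>For \<open>q \<ge> 2\<close> a step removes at most half of \<open>p\<close>, rounded
  up, so \<open>p \<le> 2 * (p - r) + 1\<close>. This is what makes the lower bound tend to
  infinity.\<close>

lemma less_two_power_slog: "2 \<le> q \<Longrightarrow> p < 2 ^ slog p q"
proof (induction p rule: less_induct)
  case (less p)
  show ?case
  proof (cases "p = 0")
    case False
    define r where "r = nat \<lceil>real p / real q\<rceil>"
    have r: "r \<ge> 1" "r \<le> p" "(r - 1) * q < p"
      unfolding r_def by (rule ceiling_quotient_bounds; use False less.prems in simp)+
    have "(r - 1) * 2 \<le> (r - 1) * q" using less.prems by (intro mult_left_mono) auto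
    then have "p \<le> 2 * (p - r) + 1" using r by linarith
    moreover have "p - r < 2 ^ slog (p - r) q" by (rule less.IH) (use r less.prems in auto)
    moreover have "slog p q = slog (p - r) q + 1"
      using slog_step[of p q] False less.prems by (simp add: r_def)
    ultimately show ?thesis by simp
  qed simp
qed

lemma chi_bounds:
  assumes "1 \<le> n" "m \<le> n\<^sup>2 - 1"
  shows "slog n (m + 1) \<le> chi n m" "chi n m \<le> slog n ((m + 1)\<^sup>2)"
proof -
  define C where "C = {chromatic_number n E | E. quantum_graph n m E}"
  \<comment> \<open>The upper bound makes the set of values finite, and the graph obtained next
    makes it nonempty, so \<open>Max\<close> is a true maximum.\<close>
  have "C \<subseteq> {..slog n ((m + 1)\<^sup>2)}" using chromatic_number_le by (auto simp: C_def)
  then have fin: "finite C" by (rule finite_subset) simp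
  obtain E where E: "quantum_graph n m E" "slog n (m + 1) \<le> chromatic_number n E"
    using high_chromatic_graph_exists[OF assms] by blast
  then have "chromatic_number n E \<in> C" by (auto simp: C_def)
  then have "chromatic_number n E \<le> Max C" "Max C \<in> C" using fin by (auto intro: Max_in)
  then show "slog n (m + 1) \<le> chi n m" "chi n m \<le> slog n ((m + 1)\<^sup>2)"
    using E(2) \<open>C \<subseteq> _\<close> by (auto simp: chi_def C_def[symmetric])
qed

theorem theorem2:
  shows "(\<forall>n m. 1 \<le> n \<longrightarrow> m \<le> n^2 - 1 \<longrightarrow>
            slog n (m + 1) \<le> chi n m \<and> chi n m \<le> slog n ((m + 1)^2))
       \<and> (\<forall>m \<ge> 1. filterlim (\<lambda>n. chi n m) at_top sequentially)"
proof (intro conjI allI impI)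
  fix m :: nat assume m: "1 \<le> m"
  show "filterlim (\<lambda>n. chi n m) at_top sequentially"
    unfolding filterlim_at_top eventually_sequentially
  proof (intro allI exI impI)
    \<comment> \<open>The power makes \<open>slog\<close> exceed \<open>Z\<close>; adding
      \<open>m\<close> ensures \<open>m \<le> n\<^sup>2 - 1\<close>.\<close>
    fix Z n :: nat assume n: "2 ^ Z + m \<le> n"
    have "n \<le> n\<^sup>2" by (simp add: power2_eq_square)
    moreover have "(1::nat) \<le> 2 ^ Z" by simp
    ultimately have "1 \<le> n" "m \<le> n\<^sup>2 - 1" using n by linarith+
    have "2 ^ Z \<le> n" using n by simp
    also have "n < 2 ^ slog n (m + 1)" by (rule less_two_power_slog) (use m in simp)
    finally have "Z < slog n (m + 1)" by simp
    then show "Z \<le> chi n m" using chi_bounds(1)[OF \<open>1 \<le> n\<close> \<open>m \<le> n\<^sup>2 - 1\<close>] by simp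
  qed
next
  fix n m :: nat assume "1 \<le> n" "m \<le> n^2 - 1"
  then show "slog n (m + 1) \<le> chi n m" "chi n m \<le> slog n ((m + 1)^2)"
    by (rule chi_bounds)+
qed

end
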